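(* Let $p$ be an odd prime such that $p\equiv\pm1\pmod5$. Then $$\sum_{k=0}^{p-1}\frac{\binom{2k}{k}^2\binom{4k}{2k}}{(-2^{14}\cdot3^4\cdot5)^k}\equiv\begin{cases}4x^2\pmod p&\text{if } p=x^2+25y^2\text{ with } x,y\in\mathbb{Z},\\ 0\pmod{p^2}&\text{if } p\equiv3\pmod4.\end{cases}$$
   Context: Congruences between rational numbers modulo $p$ or $p^2$ are taken in the ring of rationals whose denominators are coprime to $p$. *)

theory Defs
  imports "HOL-Number_Theory.Number_Theory"
begin

text \<open>
  For prime \<open>p\<close> this is the localization of the integers at \<open>p\<close>;
  \<^const>\<open>quotient_of\<close> yields numerator and denominator in lowest terms.
\<close>

definition p_integral_rats :: "nat \<Rightarrow> rat set" where
  "p_integral_rats p = {r. coprime (snd (quotient_of r)) (int p)}"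

text \<open>
  Congruence modulo the ideal generated by \<open>m\<close> in \<^term>\<open>p_integral_rats p\<close>.
  Both sides are required to lie in the ring.
\<close>

definition p_integral_cong :: "nat \<Rightarrow> rat \<Rightarrow> rat \<Rightarrow> nat \<Rightarrow> bool" where
  "p_integral_cong p a b m \<longleftrightarrow>
     a \<in> p_integral_rats p \<and> b \<in> p_integral_rats p \<and>
     (\<exists>c \<in> p_integral_rats p. a - b = of_nat m * c)"

end

theory Submission
  imports Defs
    "HOL-Computational_Algebra.Polynomial"
    "HOL-Computational_Algebra.Formal_Power_Series"
    "HOL-Computational_Algebra.Polynomial_FPS"
begin

text \<open>
  Write \<open>n = (p - 1) div 2\<close>, \<open>a k = (4k choose 2k) (2k choose k)\<close> and
  \<open>b k = (2k choose k)^2 (4k choose 2k)\<close>, let \<open>M = -(2^14 3^4 5)\<close>, and let \<open>r\<close> be a square root of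
  \<open>5\<close> modulo \<open>p^2\<close>; it exists because \<open>p\<close> is \<open>1\<close> or \<open>-1\<close> modulo \<open>5\<close>. There is an integer \<open>x\<close> with
  \<open>M x (1 - 64 x) = 1\<close> modulo \<open>p^2\<close>, namely \<open>64 x = (360 - 161 r) / 720\<close>.

  \<^item> Clausen's identity \<open>(\<Sum>k. a k x^k)^2 = \<Sum>k. b k (x (1 - 64 x))^k\<close> survives
    truncation at \<open>k < p\<close> modulo \<open>p^2\<close> (\<open>clausen_truncated\<close>). Hence the sum in the theorem is
    congruent modulo \<open>p^2\<close> to \<open>h^2\<close>, where \<open>h = \<Sum>k<p. a k x^k\<close>.

  \<^item> Modulo \<open>p\<close>, up to the sign \<open>(24 r)^n\<close>, the number \<open>h\<close> is the Hasse invariant of the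
    elliptic curve \<open>Y^2 = X^3 + 24 r X^2 + (360 - 161 r) X\<close>, that is, the coefficient of
    \<open>X^(p - 1)\<close> in the \<open>n\<close>-th power of the right-hand side (\<open>quartic_sum_cong_hasse\<close>).

  \<^item> For \<open>r = sqrt 5\<close> this curve has complex multiplication by the order of discriminant
    \<open>-100\<close>. It is the image of \<open>y^2 = x^3 - r x\<close> under an explicit isogeny of degree \<open>5\<close>, and
    isogenous curves have the same Hasse invariant (\<open>hasse_invariant_isogeny\<close>, proved with the
    Cartier operator, and \<open>hasse_invariant_5_isogeny\<close>). The Hasse invariant of \<open>y^2 = x^3 - r x\<close>
    is \<open>0\<close> for odd \<open>n\<close> and \<open>(n choose n/2) (-r)^(n/2)\<close> for even \<open>n\<close>.

  \<^item> If \<open>p = 3\<close> modulo \<open>4\<close>, then \<open>n\<close> is odd, so \<open>p\<close> divides \<open>h\<close> and \<open>p^2\<close> divides \<open>h^2\<close>.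

  \<^item> If \<open>p = x^2 + 25 y^2\<close>, then \<open>n\<close> is even. Write \<open>p = a^2 + b^2\<close> with \<open>a\<close> odd, so that
    \<open>a\<close> is either \<open>x\<close> or \<open>5 y\<close>. Then \<open>h^2\<close> is congruent to \<open>(n choose n/2)^2\<close> times the Legendre
    symbol of \<open>r\<close>. The first factor is \<open>4 a^2\<close> modulo \<open>p\<close> by a theorem of Gauss
    (\<open>gauss_binomial_square\<close>, through Jacobsthal sums). The symbol of \<open>r\<close> is the rational quartic
    symbol of \<open>5\<close>; it is \<open>1\<close> if \<open>5\<close> divides \<open>b\<close> and \<open>-1\<close> if \<open>5\<close> divides \<open>a\<close> (\<open>chi_sqrt_5\<close>). Both
    cases give \<open>4 x^2\<close>.
\<close>

section \<open>Central binomial coefficients modulo a prime\<close>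

lemma coprime_int_less_prime:
  assumes "prime p" "0 < j" "j < p"
  shows "coprime (int j) (int p)"
proof -
  have "\<not> p dvd j"
    using assms nat_dvd_not_less by blast
  then show ?thesis
    using assms(1) by (metis coprime_commute coprime_int_iff prime_imp_coprime)
qed

lemma central_binomial_rec: "Suc j * ((2 * Suc j) choose Suc j) = 2 * (2 * j + 1) * ((2 * j) choose j)"
proof -
  have "Suc j * (Suc (Suc (2 * j)) choose Suc j) = Suc (Suc (2 * j)) * (Suc (2 * j) choose j)"
    by (rule Suc_times_binomial)
  also have "Suc (2 * j) choose j = Suc (2 * j) choose Suc j"
    using binomial_symmetric[of j "Suc (2 * j)"] by (simp add: Suc_diff_le)
  finally have 1: "Suc j * (Suc (Suc (2 * j)) choose Suc j) = 2 * (Suc j * (Suc (2 * j) choose Suc j))"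
    by simp
  have "Suc j * (Suc (2 * j) choose Suc j) = Suc (2 * j) * ((2 * j) choose j)"
    by (rule Suc_times_binomial)
  with 1 show ?thesis by simp
qed

lemma central_binomial_cong:
  assumes "prime p" "p = 2 * n + 1" "j \<le> n"
  shows "[int ((2 * j) choose j) = (-4) ^ j * int (n choose j)] (mod int p)"
  using assms(3)
proof (induction j)
  case 0
  then show ?case by simp
next
  case (Suc j)
  have "(n choose Suc j) * Suc j = (n choose j) * (n - j)"
    using binomial_absorb_comp[of n j] binomial_absorption[of j "n"] Suc.prems
    by (metis Suc_times_binomial_add binomial_absorb_comp mult.commute times_binomial_minus1_eq)
  then have b: "int (Suc j) * int (n choose Suc j) = (int n - int j) * int (n choose j)"
    using Suc.prems by (metis Suc_leD mult.commute of_nat_diff of_nat_mult)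
  have "[2 * (2 * int j + 1) = (-4) * (int n - int j)] (mod int p)"
    unfolding assms(2) cong_iff_dvd_diff by (auto simp: algebra_simps intro: dvdI[of _ _ 2])
  from cong_mult[OF this Suc.IH] Suc.prems
  have "[2 * (2 * int j + 1) * int ((2 * j) choose j)
      = (-4) * (int n - int j) * ((-4) ^ j * int (n choose j))] (mod int p)"
    by simp
  also have "2 * (2 * int j + 1) * int ((2 * j) choose j) = int (Suc j) * int ((2 * Suc j) choose Suc j)"
    using arg_cong[OF central_binomial_rec[of j], of int] by (simp only: of_nat_mult) simp
  also have "(-4) * (int n - int j) * ((-4) ^ j * int (n choose j))
      = int (Suc j) * ((-4) ^ Suc j * int (n choose Suc j))"
  proof -
    have "(-4) * (int n - int j) * ((-4) ^ j * int (n choose j))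
        = (-4) ^ Suc j * ((int n - int j) * int (n choose j))"
      by (simp only: power_Suc mult_ac)
    then show ?thesis
      unfolding b[symmetric] by (simp only: mult_ac)
  qed
  finally show ?case
    using coprime_int_less_prime[OF assms(1), of "Suc j"] assms(2) Suc.prems
    by (subst (asm) cong_mult_lcancel) simp_all
qed

section \<open>Clausen's identity\<close>

unbundle fps_syntax

text \<open>
  The coefficients of the hypergeometric series \<open>2F1(1/4, 3/4; 1; 64 x)\<close>.
\<close>

definition quartic_coeff :: "nat \<Rightarrow> nat" where
  "quartic_coeff k = ((4 * k) choose (2 * k)) * ((2 * k) choose k)"

text \<open>
  The coefficients of the hypergeometric series \<open>3F2(1/2, 1/4, 3/4; 1, 1; 256 x)\<close>.
\<close>

definition cubic_coeff :: "nat \<Rightarrow> nat" where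
  "cubic_coeff k = ((2 * k) choose k)\<^sup>2 * ((4 * k) choose (2 * k))"

lemma choose_4k_2k_rec:
  "Suc k * (2 * k + 1) * ((4 * Suc k) choose (2 * Suc k))
    = 2 * (4 * k + 1) * (4 * k + 3) * ((4 * k) choose (2 * k))"
proof -
  have 1: "Suc (2 * k) * ((4 * k + 2) choose Suc (2 * k)) = 2 * (4 * k + 1) * ((4 * k) choose (2 * k))"
    using central_binomial_rec[of "2 * k"] by simp
  define Z where "Z = (4 * Suc k) choose (2 * Suc k)"
  have e: "2 * Suc (Suc (2 * k)) = 4 * Suc k" "2 * Suc (2 * k) = 4 * k + 2" "Suc (Suc (2 * k)) = 2 * Suc k"
    by simp_all
  have "2 * Suc k * Z = 2 * (4 * k + 2 + 1) * ((4 * k + 2) choose Suc (2 * k))"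
    using central_binomial_rec[of "Suc (2 * k)"] unfolding e(1,2) unfolding e(3) Z_def .
  moreover have "4 * k + 2 + 1 = 4 * k + (3 :: nat)"
    by simp
  ultimately have "2 * (Suc k * Z) = 2 * ((4 * k + 3) * ((4 * k + 2) choose Suc (2 * k)))"
    by (simp only: mult.assoc)
  then have 2: "Suc k * ((4 * Suc k) choose (2 * Suc k)) = (4 * k + 3) * ((4 * k + 2) choose Suc (2 * k))"
    unfolding Z_def by (subst (asm) mult_cancel1) simp
  have "Suc k * (2 * k + 1) * ((4 * Suc k) choose (2 * Suc k))
      = (2 * k + 1) * (Suc k * ((4 * Suc k) choose (2 * Suc k)))"
    by (simp only: mult_ac)
  also have "\<dots> = (4 * k + 3) * (Suc (2 * k) * ((4 * k + 2) choose Suc (2 * k)))"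
    unfolding 2 by (simp add: mult_ac del: mult_Suc binomial_Suc_Suc)
  also have "\<dots> = 2 * (4 * k + 1) * (4 * k + 3) * ((4 * k) choose (2 * k))"
    unfolding 1 by (simp add: mult_ac del: mult_Suc)
  finally show ?thesis .
qed

lemma quartic_coeff_rec:
  "(Suc k)\<^sup>2 * quartic_coeff (Suc k) = 4 * (4 * k + 1) * (4 * k + 3) * quartic_coeff k"
proof -
  have "(2 * k + 1) * ((Suc k)\<^sup>2 * quartic_coeff (Suc k))
      = (Suc k * (2 * k + 1) * ((4 * Suc k) choose (2 * Suc k))) * (Suc k * ((2 * Suc k) choose Suc k))"
    unfolding quartic_coeff_def power2_eq_square by (simp only: mult_ac)
  also have "\<dots> = (2 * k + 1) * (4 * (4 * k + 1) * (4 * k + 3) * quartic_coeff k)"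
    unfolding choose_4k_2k_rec central_binomial_rec quartic_coeff_def by (simp add: algebra_simps)
  finally show ?thesis
    by (simp only: mult_cancel1) simp
qed

lemma cubic_coeff_rec:
  "Suc k ^ 3 * cubic_coeff (Suc k) = 8 * (2 * k + 1) * (4 * k + 1) * (4 * k + 3) * cubic_coeff k"
proof -
  have *: "cubic_coeff k = quartic_coeff k * ((2 * k) choose k)" for k
    by (simp add: cubic_coeff_def quartic_coeff_def power2_eq_square mult_ac)
  have "Suc k ^ 3 * cubic_coeff (Suc k)
      = ((Suc k)\<^sup>2 * quartic_coeff (Suc k)) * (Suc k * ((2 * Suc k) choose Suc k))"
    unfolding * power2_eq_square power3_eq_cube by (simp only: mult_ac)
  also have "\<dots> = 8 * (2 * k + 1) * (4 * k + 1) * (4 * k + 3) * cubic_coeff k"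
    unfolding quartic_coeff_rec central_binomial_rec * by (simp add: algebra_simps)
  finally show ?thesis .
qed

text \<open>
  The power series \<open>X (1 - 64 X)\<close>, the argument at which Clausen's identity evaluates the \<open>3F2\<close>
  series.
\<close>

definition clausen_arg :: "int fps" where
  "clausen_arg = fps_X - fps_const 64 * fps_X ^ 2"

lemma clausen_arg_mult_nth:
  "(clausen_arg * f) $ m = (if m = 0 then 0 else f $ (m - 1)) - 64 * (if m < 2 then 0 else f $ (m - 2))"
proof -
  have "clausen_arg * f = fps_X * f - fps_const 64 * (fps_X ^ 2 * f)"
    by (simp add: clausen_arg_def algebra_simps)
  then show ?thesis
    by (simp only: fps_sub_nth fps_mult_left_const_nth fps_X_mult_nth fps_X_power_mult_nth)
qed

lemma clausen_arg_nth_0: "clausen_arg $ 0 = 0"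
  by (simp add: clausen_arg_def)

lemma clausen_arg_nonzero: "clausen_arg \<noteq> 0"
proof
  assume "clausen_arg = 0"
  then have "(clausen_arg * 1) $ 1 = 0" by simp
  then show False unfolding clausen_arg_mult_nth by simp
qed

lemma fps_deriv_clausen_arg: "fps_deriv clausen_arg = 1 - fps_const 128 * fps_X"
  unfolding clausen_arg_def by (simp add: power2_eq_square algebra_simps flip: numeral_fps_const)

lemma fps_deriv_clausen_arg_square:
  "fps_deriv clausen_arg * fps_deriv clausen_arg = 1 - fps_const 256 * clausen_arg"
  unfolding fps_deriv_clausen_arg unfolding clausen_arg_def
  by (simp add: algebra_simps power2_eq_square numeral_fps_const)

text \<open>
  The third-order equation satisfied by both sides of Clausen's identity, where
  \<open>y = X (1 - 64 X)\<close>. Its indicial polynomial at \<open>0\<close> is the cube \<open>m^3\<close>, so the constant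
  coefficient determines a solution.
\<close>

lemma clausen_ode_unique:
  assumes "fps_deriv (clausen_arg * fps_deriv (clausen_arg * fps_deriv f))
      = 48 * (clausen_arg * fps_deriv f) + 24 * (fps_deriv clausen_arg * f)"
    and "f $ 0 = 0"
  shows "f = 0"
proof (rule fps_ext)
  fix m show "f $ m = 0 $ m"
  proof (induction m rule: less_induct)
    case (less m)
    show ?case
    proof (cases m)
      case 0
      then show ?thesis using assms(2) by simp
    next
      case (Suc k)
      have z: "f $ i = 0" if "i \<le> k" for i
        using less Suc that by simp
      have "fps_deriv (clausen_arg * fps_deriv (clausen_arg * fps_deriv f)) $ k
          = int (Suc k) ^ 3 * f $ Suc k"
        unfolding fps_deriv_nth clausen_arg_mult_nth
        by (cases k) (simp_all only: fps_deriv_nth clausen_arg_mult_nth, simp_all add: z power3_eq_cube algebra_simps)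
      moreover have "(48 * (clausen_arg * fps_deriv f) + 24 * (fps_deriv clausen_arg * f)) $ k = 0"
      proof -
        have "(clausen_arg * fps_deriv f) $ k = 0"
          by (auto simp add: clausen_arg_mult_nth z)
        moreover have "(fps_deriv clausen_arg * f) $ k = 0"
          using z unfolding fps_mult_nth by (intro sum.neutral) auto
        ultimately show ?thesis
          by (simp add: numeral_fps_const)
      qed
      ultimately have "int (Suc k) ^ 3 * f $ Suc k = 0"
        using assms(1) by metis
      then show ?thesis
        using Suc by (simp del: of_nat_Suc)
    qed
  qed
qed

text \<open>
  The series \<open>G\<close> of the coefficients \<open>quartic_coeff\<close> satisfies \<open>(y G')' = 12 G\<close>, so \<open>G^2\<close>
  satisfies the symmetric square \<open>(y (y H')')' = 48 y H' + 24 y' H\<close> of this equation. So does the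
  composition of the series of \<open>cubic_coeff\<close> with \<open>y\<close>, because \<open>y'^2 = 1 - 256 y\<close> turns the
  hypergeometric equation of \<open>3F2\<close> into the same equation.
\<close>

theorem clausen:
  "Abs_fps (\<lambda>k. int (quartic_coeff k)) ^ 2 = fps_compose (Abs_fps (\<lambda>k. int (cubic_coeff k))) clausen_arg"
proof -
  define G where "G = Abs_fps (\<lambda>k. int (quartic_coeff k))"
  define B where "B = Abs_fps (\<lambda>k. int (cubic_coeff k))"
  define K where "K = fps_compose B clausen_arg"
  define y where "y = clausen_arg"
  define w where "w = fps_deriv y"

  have G_ode: "fps_deriv (y * fps_deriv G) = 12 * G"
  proof (rule fps_ext)
    fix m
    have "int ((Suc m)\<^sup>2 * quartic_coeff (Suc m)) = int (4 * (4 * m + 1) * (4 * m + 3) * quartic_coeff m)"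
      unfolding quartic_coeff_rec ..
    then have rec: "(int m + 1) * ((int m + 1) * int (quartic_coeff (Suc m)))
        = 4 * (4 * int m + 1) * (4 * int m + 3) * int (quartic_coeff m)"
      by (simp add: power2_eq_square algebra_simps)
    have nth: "(y * fps_deriv G) $ Suc m = (int m + 1) * int (quartic_coeff (Suc m)) - 64 * (int m * int (quartic_coeff m))"
      unfolding y_def clausen_arg_mult_nth by (cases m) (simp_all add: G_def)
    have "fps_deriv (y * fps_deriv G) $ m
        = (int m + 1) * ((int m + 1) * int (quartic_coeff (Suc m))) - 64 * (int m + 1) * (int m * int (quartic_coeff m))"
      unfolding fps_deriv_nth Suc_eq_plus1[symmetric] nth by (simp add: algebra_simps)
    also have "\<dots> = 12 * int (quartic_coeff m)"
      unfolding rec by (simp add: algebra_simps)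
    finally show "fps_deriv (y * fps_deriv G) $ m = (12 * G) $ m"
      by (simp add: G_def numeral_fps_const)
  qed

  define M where "M = y * fps_deriv (G ^ 2)"
  define P where "P = y * fps_deriv G"
  have P: "fps_deriv P = 12 * G"
    using G_ode by (simp add: P_def)
  have M: "M = 2 * G * P"
    by (simp add: M_def P_def fps_deriv_power power2_eq_square algebra_simps)
  have "fps_deriv M = 2 * (fps_deriv G * P) + 24 * (G * G)"
    unfolding M by (simp add: P algebra_simps)
  then have "y * fps_deriv M = 2 * ((y * fps_deriv G) * P) + 24 * (y * (G * G))"
    by (simp add: algebra_simps)
  then have "y * fps_deriv M = 2 * (P * P) + 24 * (y * G ^ 2)"
    unfolding P_def[symmetric] power2_eq_square .
  then have "fps_deriv (y * fps_deriv M)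
      = 4 * (P * fps_deriv P) + 24 * (w * G ^ 2) + 24 * (y * fps_deriv (G ^ 2))"
    by (simp add: w_def power2_eq_square algebra_simps)
  also have "4 * (P * fps_deriv P) = 24 * M"
    unfolding P M by (simp add: algebra_simps)
  finally have "fps_deriv (y * fps_deriv M) = 48 * M + 24 * (w * G ^ 2)"
    unfolding M_def[symmetric] by (simp add: algebra_simps)
  then have ode1: "fps_deriv (y * fps_deriv (y * fps_deriv (G ^ 2)))
      = 48 * (y * fps_deriv (G ^ 2)) + 24 * (w * G ^ 2)"
    by (simp add: M_def)

  \<comment> \<open>In terms of the Euler operator \<open>X d/dX\<close>, whose powers take \<open>B\<close> to \<open>B1\<close>, \<open>B2\<close> and \<open>B3\<close>, the recurrence for
      the coefficients is a linear relation between these series.\<close>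
  define B1 where "B1 = fps_X * fps_deriv B"
  define B2 where "B2 = fps_X * fps_deriv B1"
  define B3 where "B3 = fps_X * fps_deriv B2"
  have euler_nth: "(fps_X * fps_deriv f) $ j = int j * f $ j" for f :: "int fps" and j
    by (cases j) simp_all
  have B1_nth: "B1 $ j = int j * int (cubic_coeff j)" for j
    unfolding B1_def euler_nth by (simp add: B_def)
  have B2_nth: "B2 $ j = int j ^ 2 * int (cubic_coeff j)" for j
    unfolding B2_def euler_nth B1_nth by (simp add: power2_eq_square)
  have B3_nth: "B3 $ j = int j ^ 3 * int (cubic_coeff j)" for j
    unfolding B3_def euler_nth B2_nth by (simp add: power2_eq_square power3_eq_cube)
  have B_ode: "B3 = fps_X * (256 * B3 + 384 * B2 + 176 * B1 + 24 * B)"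
  proof (rule fps_ext)
    fix m
    show "B3 $ m = (fps_X * (256 * B3 + 384 * B2 + 176 * B1 + 24 * B)) $ m"
    proof (cases m)
      case 0
      then show ?thesis by (simp add: B3_nth)
    next
      case (Suc k)
      have "int (Suc k ^ 3 * cubic_coeff (Suc k))
          = int (8 * (2 * k + 1) * (4 * k + 1) * (4 * k + 3) * cubic_coeff k)"
        unfolding cubic_coeff_rec ..
      then have "B3 $ Suc k
          = 8 * (2 * int k + 1) * (4 * int k + 1) * (4 * int k + 3) * int (cubic_coeff k)"
        unfolding B3_nth by (simp add: algebra_simps)
      also have "\<dots> = 256 * B3 $ k + 384 * B2 $ k + 176 * B1 $ k + 24 * B $ k"
        by (simp add: B1_nth B2_nth B3_nth B_def algebra_simps power3_eq_cube power2_eq_square)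
      finally show ?thesis
        unfolding Suc by (simp add: numeral_fps_const)
    qed
  qed
  have theta: "y * fps_deriv (fps_compose f y) = w * fps_compose (fps_X * fps_deriv f) y" for f
    using clausen_arg_nth_0
    by (simp add: y_def w_def fps_compose_deriv fps_compose_mult_distrib mult_ac)
  define C1 where "C1 = fps_compose B1 y"
  define C2 where "C2 = fps_compose B2 y"
  define C3 where "C3 = fps_compose B3 y"
  have K1: "y * fps_deriv K = w * C1" and C1: "y * fps_deriv C1 = w * C2"
    and C2: "y * fps_deriv C2 = w * C3"
    using theta[of B] theta[of B1] theta[of B2]
    by (simp_all add: K_def C1_def C2_def C3_def B1_def B2_def B3_def flip: y_def)
  have C3: "C3 = y * (256 * C3 + 384 * C2 + 176 * C1 + 24 * K)"
    unfolding C3_def by (subst B_ode)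
      (simp add: clausen_arg_nth_0 y_def C1_def C2_def C3_def K_def fps_compose_mult_distrib fps_compose_add_distrib numeral_fps_const)
  have w': "fps_deriv w = - 128"
    by (simp add: w_def y_def fps_deriv_clausen_arg numeral_fps_const)
  have ww: "w * w = 1 - 256 * y"
    using fps_deriv_clausen_arg_square by (simp add: w_def y_def numeral_fps_const)
  have "y * fps_deriv (w * C1) = - 128 * (y * C1) + w * (y * fps_deriv C1)"
    by (simp add: w' algebra_simps)
  also have "\<dots> = - 128 * (y * C1) + (w * w) * C2"
    by (simp add: C1 algebra_simps)
  finally have N: "y * fps_deriv (w * C1) = - 128 * (y * C1) + C2 - 256 * (y * C2)"
    by (simp add: ww algebra_simps)
  have "y * fps_deriv (y * fps_deriv (w * C1))
      = - 128 * (y * w * C1) - 128 * y * (y * fps_deriv C1) + y * fps_deriv C2 - 256 * (y * w * C2) - 256 * y * (y * fps_deriv C2)"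
    unfolding N by (simp add: algebra_simps flip: w_def)
  also have "\<dots> = w * (C3 - y * (256 * C3 + 384 * C2 + 128 * C1))"
    unfolding C1 C2 by (simp add: algebra_simps)
  also have "C3 - y * (256 * C3 + 384 * C2 + 128 * C1) = y * (48 * C1 + 24 * K)"
    by (subst (1) C3) (simp add: algebra_simps)
  also have "w * \<dots> = y * (48 * (w * C1) + 24 * (w * K))"
    by (simp add: algebra_simps)
  finally have ode2: "fps_deriv (y * fps_deriv (y * fps_deriv K)) = 48 * (y * fps_deriv K) + 24 * (w * K)"
    using clausen_arg_nonzero by (simp add: K1 flip: y_def)

  have "G ^ 2 - K = 0"
  proof (rule clausen_ode_unique)
    show "fps_deriv (clausen_arg * fps_deriv (clausen_arg * fps_deriv (G ^ 2 - K)))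
        = 48 * (clausen_arg * fps_deriv (G ^ 2 - K)) + 24 * (fps_deriv clausen_arg * (G ^ 2 - K))"
      using ode1 ode2 by (simp only: fps_deriv_sub right_diff_distrib flip: y_def w_def) simp
    show "(G ^ 2 - K) $ 0 = 0"
      by (simp add: K_def G_def B_def quartic_coeff_def cubic_coeff_def power2_eq_square)
  qed
  then show ?thesis
    by (simp add: G_def K_def B_def y_def)
qed

section \<open>Clausen's identity for truncated series\<close>

text \<open>
  In the recurrence for \<open>quartic_coeff\<close> the prime \<open>p\<close> divides a factor of the numerator when \<open>4k\<close>
  passes \<open>p\<close> and again when it passes \<open>3p\<close>, while the denominators \<open>(k + 1)^2\<close> stay coprime to \<open>p\<close>
  as long as \<open>k + 1 < p\<close>.
\<close>

lemma prime_dvd_quartic_coeff: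
  assumes p: "prime p" "odd p" and "k < p" "p \<le> 4 * k"
  shows "p dvd quartic_coeff k"
  using assms(3,4)
proof (induction k)
  case (Suc k)
  have "p dvd 4 * (4 * k + 1) * (4 * k + 3) * quartic_coeff k"
  proof (cases "p \<le> 4 * k")
    case False
    with Suc.prems p(2) have "p = 4 * k + 1 \<or> p = 4 * k + 3"
      by presburger
    then have "p dvd 4 * k + 1 \<or> p dvd 4 * k + 3"
      by auto
    then show ?thesis
      by (metis dvd_mult dvd_mult2)
  qed (use Suc in simp)
  then have "p dvd (Suc k)\<^sup>2 * quartic_coeff (Suc k)"
    by (simp only: quartic_coeff_rec)
  then show ?case
    using Suc.prems(1) p(1) prime_dvd_mult_iff prime_dvd_power nat_dvd_not_less by blast
qed (use p in \<open>auto simp: prime_gt_0_nat\<close>)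

lemma coprime_power_less_prime:
  fixes p :: nat
  assumes "prime p" "0 < k" "k < p"
  shows "coprime (p ^ i) (k ^ j)"
  using assms coprime_int_less_prime[OF assms] by (auto simp: coprime_commute)

lemma prime_square_dvd_quartic_coeff:
  assumes p: "prime p" "odd p" and "k < p" "3 * p \<le> 4 * k"
  shows "p\<^sup>2 dvd quartic_coeff k"
  using assms(3,4)
proof (induction k)
  case (Suc k)
  have "p\<^sup>2 dvd 4 * (4 * k + 1) * (4 * k + 3) * quartic_coeff k"
  proof (cases "3 * p \<le> 4 * k")
    case False
    with Suc.prems p(2) have "3 * p = 4 * k + 1 \<or> 3 * p = 4 * k + 3"
      by presburger
    moreover have "p dvd quartic_coeff k"
      using Suc.prems calculation p prime_gt_1_nat[OF p(1)] by (intro prime_dvd_quartic_coeff) auto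
    ultimately show ?thesis
      unfolding power2_eq_square by (metis dvd_triv_right mult_dvd_mono dvd_mult dvd_mult2)
  qed (use Suc in simp)
  then have "p\<^sup>2 dvd (Suc k)\<^sup>2 * quartic_coeff (Suc k)"
    by (simp only: quartic_coeff_rec)
  then show ?case
    using coprime_power_less_prime[OF p(1) _ Suc.prems(1), of 2 2] by (simp add: coprime_dvd_mult_right_iff)
qed (use p in \<open>auto simp: prime_gt_0_nat\<close>)

lemma prime_square_dvd_quartic_coeff_mult:
  assumes p: "prime p" "odd p" and "i < p" "j < p" "p \<le> i + j"
  shows "p\<^sup>2 dvd quartic_coeff i * quartic_coeff j"
proof -
  consider "3 * p \<le> 4 * i" | "3 * p \<le> 4 * j" | "p \<le> 4 * i" "p \<le> 4 * j"
    using assms(5) by linarith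
  then show ?thesis
    using prime_square_dvd_quartic_coeff[OF p] prime_dvd_quartic_coeff[OF p] assms(3,4)
    by cases (auto simp: power2_eq_square intro: mult_dvd_mono)
qed

lemma prime_square_dvd_cubic_coeff:
  assumes p: "prime p" "odd p" and "k < p" "p \<le> 2 * k"
  shows "p\<^sup>2 dvd cubic_coeff k"
proof -
  have "p dvd (2 * k) choose k"
    using assms(3,4)
  proof (induction k)
    case (Suc k)
    have "p dvd 2 * (2 * k + 1) * ((2 * k) choose k)"
    proof (cases "p \<le> 2 * k")
      case False
      with Suc.prems p(2) have "p = 2 * k + 1"
        by presburger
      then have "p dvd 2 * k + 1"
        by simp
      then show ?thesis
        by (metis dvd_mult dvd_mult2)
    qed (use Suc in simp)
    then have "p dvd Suc k * ((2 * Suc k) choose Suc k)"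
      by (simp only: central_binomial_rec)
    then show ?case
      using Suc.prems(1) p(1) prime_dvd_mult_iff nat_dvd_not_less by blast
  qed (use p in \<open>auto simp: prime_gt_0_nat\<close>)
  then show ?thesis
    by (simp add: cubic_coeff_def)
qed

text \<open>
  Clausen's identity read off at the coefficient of \<open>X^m\<close>.
\<close>

lemma clausen_coeff:
  "(\<Sum>i\<le>m. int (quartic_coeff i) * int (quartic_coeff (m - i)))
    = (\<Sum>k\<le>m. int (cubic_coeff k) * coeff ([:0, 1, -64:] ^ k) m)"
proof -
  have y: "clausen_arg = fps_of_poly [:0, 1, -64:]"
    by (rule fps_ext) (auto simp: clausen_arg_def coeff_pCons fps_X_power_nth split: nat.split)
  have "(Abs_fps (\<lambda>k. int (quartic_coeff k)) ^ 2) $ m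
      = (\<Sum>i\<le>m. int (quartic_coeff i) * int (quartic_coeff (m - i)))"
    by (simp add: power2_eq_square fps_mult_nth atLeast0AtMost)
  moreover have "fps_compose (Abs_fps (\<lambda>k. int (cubic_coeff k))) clausen_arg $ m
      = (\<Sum>k\<le>m. int (cubic_coeff k) * coeff ([:0, 1, -64:] ^ k) m)"
    by (simp add: fps_compose_nth y atLeast0AtMost flip: fps_of_poly_power)
  ultimately show ?thesis
    unfolding clausen by simp
qed

text \<open>
  For exponents below \<open>p\<close> the coefficients of the two truncated sides agree exactly. All
  contributions to higher exponents vanish modulo \<open>p^2\<close>: on the left they come from indices \<open>k\<close>
  with \<open>2k \<ge> p\<close>, on the right from pairs of indices with sum at least \<open>p\<close>.
\<close>

theorem clausen_truncated:
  fixes x :: int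
  assumes p: "prime p" "odd p"
  shows "[(\<Sum>k<p. int (cubic_coeff k) * (x * (1 - 64 * x)) ^ k)
    = (\<Sum>k<p. int (quartic_coeff k) * x ^ k)\<^sup>2] (mod (int p)\<^sup>2)"
proof -
  define c where "c m = (\<Sum>i\<le>m. int (quartic_coeff i) * int (quartic_coeff (m - i)))" for m
  define y where "y = [:0, 1, -64 :: int:]"
  have deg_y: "degree (y ^ k) \<le> 2 * k" for k
    using degree_power_le[of y k] by (simp add: y_def)
  have low_y: "coeff (y ^ k) m = 0" if "m < k" for k m
  proof -
    have "y = monom 1 1 * [:1, -64:]"
      by (simp add: y_def monom_altdef)
    then have "y ^ k = monom 1 k * [:1, -64:] ^ k"
      by (simp only: power_mult_distrib monom_power) simp
    then show ?thesis
      using that by (simp add: coeff_monom_mult)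
  qed

  have "[(\<Sum>k<p. int (cubic_coeff k) * (x * (1 - 64 * x)) ^ k)
      = (\<Sum>k<p. \<Sum>m<p. int (cubic_coeff k) * coeff (y ^ k) m * x ^ m)] (mod (int p)\<^sup>2)"
  proof (rule cong_sum)
    fix k assume k: "k \<in> {..<p}"
    show "[int (cubic_coeff k) * (x * (1 - 64 * x)) ^ k
        = (\<Sum>m<p. int (cubic_coeff k) * coeff (y ^ k) m * x ^ m)] (mod (int p)\<^sup>2)"
    proof (cases "p \<le> 2 * k")
      case True
      then have "(int p)\<^sup>2 dvd int (cubic_coeff k)"
        using prime_square_dvd_cubic_coeff[OF p, of k] k by (metis lessThan_iff of_nat_dvd_iff of_nat_power)
      then have "(int p)\<^sup>2 dvd int (cubic_coeff k) * (x * (1 - 64 * x)) ^ k"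
        "(int p)\<^sup>2 dvd (\<Sum>m<p. int (cubic_coeff k) * coeff (y ^ k) m * x ^ m)"
        by (auto intro!: dvd_sum dvd_mult2)
      then show ?thesis
        by (metis cong_0_iff cong_sym cong_trans)
    next
      case False
      have "x * (1 - 64 * x) = poly y x"
        by (simp add: y_def algebra_simps)
      then have "(x * (1 - 64 * x)) ^ k = poly (y ^ k) x"
        by simp
      also have "\<dots> = (\<Sum>m<p. coeff (y ^ k) m * x ^ m)"
        unfolding poly_altdef using deg_y[of k] False
        by (intro sum.mono_neutral_left) (auto simp: coeff_eq_0)
      finally show ?thesis
        by (simp add: sum_distrib_left mult.assoc)
    qed
  qed
  also have "(\<Sum>k<p. \<Sum>m<p. int (cubic_coeff k) * coeff (y ^ k) m * x ^ m) = (\<Sum>m<p. c m * x ^ m)"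
  proof (subst sum.swap, intro sum.cong refl)
    fix m assume m: "m \<in> {..<p}"
    have "(\<Sum>k<p. int (cubic_coeff k) * coeff (y ^ k) m) = (\<Sum>k\<le>m. int (cubic_coeff k) * coeff (y ^ k) m)"
      using m by (intro sum.mono_neutral_right) (auto simp: low_y)
    then show "(\<Sum>k<p. int (cubic_coeff k) * coeff (y ^ k) m * x ^ m) = c m * x ^ m"
      by (simp add: c_def clausen_coeff y_def flip: sum_distrib_right)
  qed
  also have "[(\<Sum>m<p. c m * x ^ m) = (\<Sum>k<p. int (quartic_coeff k) * x ^ k)\<^sup>2] (mod (int p)\<^sup>2)"
  proof -
    define h where "h = (\<lambda>(i, j). int (quartic_coeff i) * int (quartic_coeff j) * x ^ (i + j))"
    have "(\<Sum>k<p. int (quartic_coeff k) * x ^ k)\<^sup>2 = (\<Sum>z\<in>{..<p} \<times> {..<p}. h z)"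
      by (simp add: power2_eq_square sum_product h_def power_add mult_ac flip: sum.cartesian_product)
    also have "\<dots> = (\<Sum>z\<in>{(i, j). i + j < p}. h z) + (\<Sum>z\<in>{..<p} \<times> {..<p} - {(i, j). i + j < p}. h z)"
      by (intro sum.subset_diff[of "{(i, j). i + j < p}" "{..<p} \<times> {..<p}" h, THEN trans]) auto
    also have "(\<Sum>z\<in>{(i, j). i + j < p}. h z) = (\<Sum>m<p. \<Sum>i\<le>m. h (i, m - i))"
      using sum.triangle_reindex[of "\<lambda>i j. h (i, j)" p] by simp
    also have "\<dots> = (\<Sum>m<p. c m * x ^ m)"
      by (intro sum.cong refl) (auto simp: h_def c_def sum_distrib_right)
    finally have *: "(\<Sum>k<p. int (quartic_coeff k) * x ^ k)\<^sup>2 - (\<Sum>m<p. c m * x ^ m)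
        = (\<Sum>z\<in>{..<p} \<times> {..<p} - {(i, j). i + j < p}. h z)"
      by simp
    have "(int p)\<^sup>2 dvd \<dots>"
    proof (rule dvd_sum)
      fix z assume "z \<in> {..<p} \<times> {..<p} - {(i, j). i + j < p}"
      then obtain i j where z: "z = (i, j)" "i < p" "j < p" "p \<le> i + j"
        by force
      then show "(int p)\<^sup>2 dvd h z"
        using prime_square_dvd_quartic_coeff_mult[OF p z(2-4)] unfolding h_def z(1) case_prod_conv
        by (metis dvd_mult2 of_nat_dvd_iff of_nat_mult of_nat_power)
    qed
    then show ?thesis
      unfolding *[symmetric] by (simp add: cong_iff_dvd_diff dvd_diff_commute)
  qed
  finally show ?thesis .
qed

section \<open>The Cartier operator modulo a prime\<close>

lemma fermat_theorem_int:
  fixes a :: int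
  assumes "prime p" "\<not> int p dvd a"
  shows "[a ^ (p - 1) = 1] (mod int p)"
proof -
  define m where "m = nat (a mod int p)"
  have m: "int m = a mod int p"
    using assms by (simp add: m_def prime_gt_0_nat)
  then have "\<not> p dvd m"
    using assms by (metis dvd_mod_iff dvd_refl of_nat_dvd_iff)
  then have "[int (m ^ (p - 1)) = int 1] (mod int p)"
    using fermat_theorem assms cong_int_iff by blast
  moreover have "[a ^ (p - 1) = int m ^ (p - 1)] (mod int p)"
    unfolding m by (intro cong_pow) (simp add: cong_def)
  ultimately show ?thesis
    by (simp add: cong_trans)
qed

text \<open>
  Coefficientwise congruence of integer polynomials. It stands for equality of polynomials over
  the field with \<open>p\<close> elements.
\<close>

definition poly_cong :: "int \<Rightarrow> int poly \<Rightarrow> int poly \<Rightarrow> bool" where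
  "poly_cong m f g \<longleftrightarrow> [:m:] dvd f - g"

lemma poly_cong_iff_coeff: "poly_cong m f g \<longleftrightarrow> (\<forall>i. [coeff f i = coeff g i] (mod m))"
  by (simp add: poly_cong_def const_poly_dvd_iff cong_iff_dvd_diff)

lemma poly_cong_refl [simp]: "poly_cong m f f"
  by (simp add: poly_cong_def)

lemma poly_cong_sym: "poly_cong m f g \<Longrightarrow> poly_cong m g f"
  by (simp add: poly_cong_iff_coeff cong_sym_eq)

lemma poly_cong_trans [trans]: "poly_cong m f g \<Longrightarrow> poly_cong m g h \<Longrightarrow> poly_cong m f h"
  unfolding poly_cong_iff_coeff by (blast intro: cong_trans)

lemma poly_cong_add: "poly_cong m f g \<Longrightarrow> poly_cong m f' g' \<Longrightarrow> poly_cong m (f + f') (g + g')"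
  unfolding poly_cong_iff_coeff by (auto intro: cong_add)

lemma poly_cong_diff: "poly_cong m f g \<Longrightarrow> poly_cong m f' g' \<Longrightarrow> poly_cong m (f - f') (g - g')"
  unfolding poly_cong_iff_coeff by (auto intro: cong_diff)

lemma poly_cong_mult:
  assumes "poly_cong m f g" "poly_cong m f' g'"
  shows "poly_cong m (f * f') (g * g')"
proof -
  have "f * f' - g * g' = (f - g) * f' + g * (f' - g')"
    by (simp add: algebra_simps)
  then show ?thesis
    using assms by (simp add: poly_cong_def)
qed

lemma poly_cong_power: "poly_cong m f g \<Longrightarrow> poly_cong m (f ^ k) (g ^ k)"
  by (induction k) (auto intro: poly_cong_mult)

lemma poly_cong_smult: "poly_cong m f g \<Longrightarrow> poly_cong m (smult c f) (smult c g)"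
  using poly_cong_mult[of m "[:c:]" "[:c:]" f g] by simp

lemma poly_cong_sum:
  "(\<And>i. i \<in> I \<Longrightarrow> poly_cong m (f i) (g i)) \<Longrightarrow> poly_cong m (sum f I) (sum g I)"
  by (induction I rule: infinite_finite_induct) (auto intro: poly_cong_add)

text \<open>
  The Cartier operator, read on the polynomial \<open>g\<close> in the differential form \<open>g dx\<close>: it keeps the
  coefficients at the exponents \<open>p j + p - 1\<close> and moves them to the exponents \<open>j\<close>. The sum may
  stop at \<open>j = degree g\<close>, as the later coefficients are zero. Modulo \<open>p\<close> the operator kills
  derivatives, and \<open>p\<close>-th powers can be pulled out of it.
\<close>

definition cartier :: "nat \<Rightarrow> int poly \<Rightarrow> int poly" where
  "cartier p g = (\<Sum>j\<le>degree g. monom (coeff g (p * j + (p - 1))) j)"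

lemma coeff_cartier:
  assumes "p > 0"
  shows "coeff (cartier p g) j = coeff g (p * j + (p - 1))"
proof (cases "j \<le> degree g")
  case True
  then show ?thesis
    by (simp add: cartier_def coeff_sum sum.delta)
next
  case False
  have "p * j + (p - 1) \<ge> j"
    using assms by (cases p) auto
  with False have "coeff g (p * j + (p - 1)) = 0"
    by (intro coeff_eq_0) auto
  then show ?thesis
    using False by (simp add: cartier_def coeff_sum sum.delta)
qed

lemma cartier_add: "p > 0 \<Longrightarrow> cartier p (f + g) = cartier p f + cartier p g"
  by (rule poly_eqI) (simp add: coeff_cartier)

lemma cartier_diff: "p > 0 \<Longrightarrow> cartier p (f - g) = cartier p f - cartier p g"
  by (rule poly_eqI) (simp add: coeff_cartier)

lemma cartier_smult: "p > 0 \<Longrightarrow> cartier p (smult c g) = smult c (cartier p g)"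
  by (rule poly_eqI) (simp add: coeff_cartier)

lemma cartier_0: "p > 0 \<Longrightarrow> cartier p 0 = 0"
  by (rule poly_eqI) (simp add: coeff_cartier)

lemma cartier_sum: "p > 0 \<Longrightarrow> cartier p (sum f I) = (\<Sum>i\<in>I. cartier p (f i))"
  by (induction I rule: infinite_finite_induct) (auto simp: cartier_add cartier_0)

lemma cartier_cong: "p > 0 \<Longrightarrow> poly_cong m f g \<Longrightarrow> poly_cong m (cartier p f) (cartier p g)"
  by (simp add: poly_cong_iff_coeff coeff_cartier)

lemma cartier_pderiv: "p > 0 \<Longrightarrow> poly_cong (int p) (cartier p (pderiv g)) 0"
  unfolding poly_cong_iff_coeff
proof
  fix i assume "p > 0"
  then have "Suc (p * i + (p - 1)) = p * (i + 1)"
    by (cases p) auto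
  then show "[coeff (cartier p (pderiv g)) i = coeff 0 i] (mod int p)"
    using \<open>p > 0\<close> by (simp add: coeff_cartier coeff_pderiv cong_0_iff del: of_nat_Suc)
qed

lemma cartier_pcompose_mult:
  assumes "p > 0"
  shows "cartier p (pcompose h (monom 1 p) * g) = h * cartier p g"
proof (induction h)
  case 0
  then show ?case using assms by (simp add: cartier_0)
next
  case (pCons a h)
  have shift: "cartier p (monom 1 p * f) = pCons 0 (cartier p f)" for f
  proof (rule poly_eqI)
    fix j
    show "coeff (cartier p (monom 1 p * f)) j = coeff (pCons 0 (cartier p f)) j"
    proof (cases j)
      case 0
      then show ?thesis
        using assms by (simp add: coeff_cartier coeff_monom_mult)
    next
      case (Suc i)
      have "p * Suc i + (p - 1) - p = p * i + (p - 1)"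
        by simp
      then show ?thesis
        using assms Suc by (simp add: coeff_cartier coeff_monom_mult)
    qed
  qed
  have "cartier p (pcompose (pCons a h) (monom 1 p) * g)
      = smult a (cartier p g) + pCons 0 (cartier p (pcompose h (monom 1 p) * g))"
    using assms
    by (simp add: pcompose_pCons ring_distribs cartier_add cartier_smult shift mult.assoc)
  also have "\<dots> = pCons a h * cartier p g"
    by (simp add: pCons.IH)
  finally show ?case .
qed

lemma power_prime_add_int_poly:
  fixes f g :: "int poly"
  assumes "prime p"
  shows "poly_cong (int p) ((f + g) ^ p) (f ^ p + g ^ p)"
proof -
  have p: "p > 0" using assms by (simp add: prime_gt_0_nat)
  have "(f + g) ^ p = (\<Sum>k\<le>p. of_nat (p choose k) * f ^ k * g ^ (p - k))"
    by (rule binomial_ring)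
  also have "{..p} = insert 0 (insert p {0<..<p})"
    using p by auto
  also have "(\<Sum>k\<in>\<dots>. of_nat (p choose k) * f ^ k * g ^ (p - k))
      = g ^ p + (f ^ p + (\<Sum>k\<in>{0<..<p}. of_nat (p choose k) * f ^ k * g ^ (p - k)))"
    using p by simp
  finally have "(f + g) ^ p - (f ^ p + g ^ p)
      = (\<Sum>k\<in>{0<..<p}. of_nat (p choose k) * f ^ k * g ^ (p - k))"
    by simp
  moreover have "[:int p:] dvd of_nat (p choose k) * f ^ k * g ^ (p - k)" if "k \<in> {0<..<p}" for k
  proof -
    have "p dvd (p choose k)"
      using that assms by (intro dvd_choose_prime) auto
    then have "[:int p:] dvd [:int (p choose k):]"
      by simp
    then show ?thesis
      by (metis dvd_mult2 of_nat_poly)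
  qed
  ultimately show ?thesis
    unfolding poly_cong_def by (simp only: dvd_sum)
qed

lemma power_prime_int_poly:
  assumes "prime p"
  shows "poly_cong (int p) (h ^ p) (pcompose h (monom 1 p))"
proof (induction h)
  case 0
  then show ?case using assms by (simp add: power_0_left prime_gt_0_nat)
next
  case (pCons a h)
  have "[a ^ p = a] (mod int p)"
  proof (cases "int p dvd a")
    case True
    moreover have "int p dvd a ^ p"
      using True prime_gt_0_nat[OF assms] by (metis dvd_power dvd_trans)
    ultimately show ?thesis
      by (metis cong_0_iff cong_sym cong_trans)
  next
    case False
    then have "[a ^ (p - 1) * a = 1 * a] (mod int p)"
      using fermat_theorem_int assms by (intro cong_mult) auto
    then show ?thesis
      using assms by (metis Suc_diff_1 mult_1 power_Suc2 prime_gt_0_nat)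
  qed
  then have a: "poly_cong (int p) ([:a:] ^ p) [:a:]"
    by (simp add: poly_const_pow poly_cong_iff_coeff coeff_pCons split: nat.split)
  have "pCons a h = [:a:] + [:0, 1:] * h"
    by simp
  then have "poly_cong (int p) (pCons a h ^ p) ([:a:] ^ p + ([:0, 1:] * h) ^ p)"
    using power_prime_add_int_poly[OF assms] by metis
  also have "poly_cong (int p) \<dots> ([:a:] + monom 1 p * pcompose h (monom 1 p))"
    unfolding power_mult_distrib
    using a pCons.IH by (intro poly_cong_add poly_cong_mult) (simp_all add: monom_altdef)
  finally show ?case
    by (simp add: pcompose_pCons)
qed

lemma cartier_power_mult:
  assumes "prime p"
  shows "poly_cong (int p) (cartier p (h ^ p * g)) (h * cartier p g)"
proof -
  have p: "p > 0" using assms by (simp add: prime_gt_0_nat)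
  have "poly_cong (int p) (cartier p (h ^ p * g)) (cartier p (pcompose h (monom 1 p) * g))"
    by (intro cartier_cong p poly_cong_mult power_prime_int_poly assms poly_cong_refl)
  then show ?thesis
    using cartier_pcompose_mult[OF p] by simp
qed

text \<open>
  The forms \<open>h^(p - 1) dh\<close> go to \<open>dh\<close>: write \<open>h^p = h(x^p) + p R\<close> over the integers, differentiate
  and divide by \<open>p\<close>.
\<close>

lemma cartier_power_pderiv:
  assumes "prime p"
  shows "poly_cong (int p) (cartier p (h ^ (p - 1) * pderiv h)) (pderiv h)"
proof -
  have p: "p > 0" using assms by (simp add: prime_gt_0_nat)
  then have Suc: "Suc (p - 1) = p" by simp
  obtain R where R: "h ^ p = pcompose h (monom 1 p) + smult (int p) R"
  proof -
    obtain R where "h ^ p - pcompose h (monom 1 p) = [:int p:] * R"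
      using power_prime_int_poly[OF assms, of h] unfolding poly_cong_def by (elim dvdE)
    then have "h ^ p = pcompose h (monom 1 p) + smult (int p) R"
      by (simp add: algebra_simps)
    then show ?thesis by (rule that)
  qed
  have "smult (int p) (h ^ (p - 1) * pderiv h) = pderiv (h ^ p)"
    using pderiv_power_Suc[of h "p - 1"] Suc by simp
  also have "\<dots> = smult (int p) (pcompose (pderiv h) (monom 1 p) * monom 1 (p - 1) + pderiv R)"
    unfolding R by (simp add: pderiv_add pderiv_pcompose pderiv_monom pderiv_smult smult_add_right
        smult_monom flip: mult_smult_right)
  finally have "h ^ (p - 1) * pderiv h = pcompose (pderiv h) (monom 1 p) * monom 1 (p - 1) + pderiv R"
    using p smult_eq_0_iff[of "int p" "h ^ (p - 1) * pderiv h -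
      (pcompose (pderiv h) (monom 1 p) * monom 1 (p - 1) + pderiv R)"]
    by (simp add: smult_diff_right)
  then have "cartier p (h ^ (p - 1) * pderiv h)
      = pderiv h * cartier p (monom 1 (p - 1)) + cartier p (pderiv R)"
    using p by (simp add: cartier_add cartier_pcompose_mult)
  also have "cartier p (monom 1 (p - 1)) = 1"
  proof (rule poly_eqI)
    show "coeff (cartier p (monom 1 (p - 1))) j = coeff 1 j" for j
      using p by (cases j) (auto simp: coeff_cartier)
  qed
  finally have eq: "cartier p (h ^ (p - 1) * pderiv h) = pderiv h + cartier p (pderiv R)"
    by simp
  have "poly_cong (int p) (pderiv h + cartier p (pderiv R)) (pderiv h + 0)"
    by (intro poly_cong_add poly_cong_refl cartier_pderiv p)
  then show ?thesis
    unfolding eq by simp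
qed



section \<open>Hasse invariants of isogenous curves\<close>

lemma coeff_linear_power_int:
  fixes a :: int
  shows "coeff ([:a, 1:] ^ m) k = int (m choose k) * a ^ (m - k)"
proof -
  have "[:a, 1:] = monom 1 1 + [:a:]"
    by (simp add: monom_altdef)
  then have "[:a, 1:] ^ m = (\<Sum>i\<le>m. of_nat (m choose i) * monom 1 1 ^ i * [:a:] ^ (m - i))"
    by (simp only: binomial_ring)
  also have "\<dots> = (\<Sum>i\<le>m. monom (int (m choose i) * a ^ (m - i)) i)"
    by (intro sum.cong refl) (simp add: of_nat_poly poly_const_pow monom_power smult_monom mult.commute)
  finally show ?thesis
    by (cases "k \<le> m") (simp_all add: coeff_sum sum.delta)
qed

text \<open>
  The Hasse invariant of the curve \<open>y^2 = x (x^2 + \<alpha> x + \<beta>)\<close>, when \<open>p = 2 n + 1\<close>.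
\<close>

lemma hasse_invariant_2_torsion:
  fixes \<alpha> \<beta> :: int
  shows "coeff ([:0, \<beta>, \<alpha>, 1:] ^ n) (2 * n)
    = (\<Sum>k\<le>n div 2. int (n choose (2 * k)) * int ((2 * k) choose k) * \<alpha> ^ (n - 2 * k) * \<beta> ^ k)"
proof -
  have "[:0, \<beta>, \<alpha>, 1:] = monom 1 1 * ([:\<beta>:] + monom 1 1 * [:\<alpha>, 1:])"
    by (simp add: monom_altdef)
  then have "[:0, \<beta>, \<alpha>, 1:] ^ n = monom 1 n * ([:\<beta>:] + monom 1 1 * [:\<alpha>, 1:]) ^ n"
    by (simp only: power_mult_distrib monom_power) simp
  then have "coeff ([:0, \<beta>, \<alpha>, 1:] ^ n) (2 * n) = coeff (([:\<beta>:] + monom 1 1 * [:\<alpha>, 1:]) ^ n) n"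
    by (simp add: coeff_monom_mult)
  also have "([:\<beta>:] + monom 1 1 * [:\<alpha>, 1:]) ^ n
      = (\<Sum>k\<le>n. of_nat (n choose k) * [:\<beta>:] ^ k * (monom 1 1 * [:\<alpha>, 1:]) ^ (n - k))"
    by (rule binomial_ring)
  also have "\<dots> = (\<Sum>k\<le>n. smult (int (n choose k) * \<beta> ^ k) (monom 1 (n - k) * [:\<alpha>, 1:] ^ (n - k)))"
    by (intro sum.cong refl)
       (simp only: of_nat_poly poly_const_pow power_mult_distrib monom_power, simp add: mult.commute)
  also have "coeff \<dots> n = (\<Sum>k\<le>n. int (n choose k) * \<beta> ^ k * (int ((n - k) choose k) * \<alpha> ^ (n - 2 * k)))"
    unfolding coeff_sum coeff_smult coeff_monom_mult coeff_linear_power_int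
    by (intro sum.cong refl) (auto simp: mult_2)
  also have "\<dots> = (\<Sum>k\<le>n div 2. int (n choose k) * \<beta> ^ k * (int ((n - k) choose k) * \<alpha> ^ (n - 2 * k)))"
    by (intro sum.mono_neutral_right) (auto simp: not_le)
  also have "\<dots> = (\<Sum>k\<le>n div 2. int (n choose (2 * k)) * int ((2 * k) choose k) * \<alpha> ^ (n - 2 * k) * \<beta> ^ k)"
  proof (intro sum.cong refl)
    fix k assume "k \<in> {..n div 2}"
    then have "(n choose (2 * k)) * ((2 * k) choose k) = (n choose k) * ((n - k) choose k)"
      using choose_mult[of k "2 * k" n] by simp
    then have "int (n choose (2 * k)) * int ((2 * k) choose k) = int (n choose k) * int ((n - k) choose k)"
      by (metis of_nat_mult)
    then show "int (n choose k) * \<beta> ^ k * (int ((n - k) choose k) * \<alpha> ^ (n - 2 * k))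
        = int (n choose (2 * k)) * int ((2 * k) choose k) * \<alpha> ^ (n - 2 * k) * \<beta> ^ k"
      by (simp add: mult_ac)
  qed
  finally show ?thesis .
qed

text \<open>
  The homogenization \<open>V^d F(U / V)\<close> of a polynomial \<open>F\<close> of degree at most \<open>d\<close>.
\<close>

definition homog :: "nat \<Rightarrow> int poly \<Rightarrow> int poly \<Rightarrow> int poly \<Rightarrow> int poly" where
  "homog d F U V = (\<Sum>i\<le>d. smult (coeff F i) (U ^ i * V ^ (d - i)))"

lemma homog_add: "homog d (F + G) U V = homog d F U V + homog d G U V"
  by (simp add: homog_def smult_add_left sum.distrib)

lemma homog_smult: "homog d (smult c F) U V = smult c (homog d F U V)"
  by (rule poly_eqI) (simp add: homog_def coeff_sum sum_distrib_left mult.assoc)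

lemma homog_pCons_0: "homog (Suc d) (pCons 0 F) U V = U * homog d F U V"
  unfolding homog_def sum.atMost_Suc_shift by (simp add: sum_distrib_left mult.assoc)

lemma homog_Suc:
  assumes "degree F \<le> d"
  shows "homog (Suc d) F U V = V * homog d F U V"
proof -
  have "coeff F (Suc d) = 0"
    using assms by (intro coeff_eq_0) auto
  moreover have "V ^ (Suc d - i) = V * V ^ (d - i)" if "i \<le> d" for i
    using that by (simp add: Suc_diff_le)
  ultimately show ?thesis
    by (simp add: homog_def sum_distrib_left mult_ac)
qed

lemma degree_cubic_power: "degree ([:0, \<beta>, \<alpha>, 1:] ^ n :: int poly) \<le> 3 * n"
  using degree_power_le[of "[:0, \<beta>, \<alpha>, 1 :: int:]" n] by simp

lemma homog_cubic_power:
  "homog (3 * n) ([:0, \<beta>, \<alpha>, 1:] ^ n) U V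
    = (U ^ 3 + smult \<alpha> (U ^ 2 * V) + smult \<beta> (U * V ^ 2)) ^ n"
proof (induction n)
  case 0
  then show ?case by (simp add: homog_def)
next
  case (Suc n)
  define G where "G = [:0, \<beta>, \<alpha>, 1:] ^ n"
  have deg: "degree G \<le> 3 * n"
    unfolding G_def by (rule degree_cubic_power)
  then have deg1: "degree (pCons 0 G) \<le> Suc (3 * n)"
    by (intro order.trans[OF degree_pCons_le]) auto
  have deg2: "degree (pCons 0 G) \<le> Suc (Suc (3 * n))"
    using deg1 by simp
  have "[:0, \<beta>, \<alpha>, 1:] ^ Suc n
      = smult \<beta> (pCons 0 G) + smult \<alpha> (pCons 0 (pCons 0 G)) + pCons 0 (pCons 0 (pCons 0 G))"
    by (simp add: G_def)
  moreover have "3 * Suc n = Suc (Suc (Suc (3 * n)))"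
    by simp
  ultimately have "homog (3 * Suc n) ([:0, \<beta>, \<alpha>, 1:] ^ Suc n) U V
      = (U ^ 3 + smult \<alpha> (U ^ 2 * V) + smult \<beta> (U * V ^ 2)) * homog (3 * n) G U V"
    using deg deg1 deg2
    by (simp only: homog_add homog_smult homog_pCons_0 homog_Suc)
       (simp add: algebra_simps power2_eq_square power3_eq_cube smult_add_right)
  then show ?case
    using Suc by (simp add: G_def)
qed

text \<open>
  With \<open>X = U / v^2\<close>, the polynomial here is \<open>v^(4p)\<close> times \<open>X^i X'\<close>. For \<open>i + 1\<close> coprime to \<open>p\<close>
  this is a derivative modulo \<open>p\<close>, since \<open>v^(4p)\<close> behaves like a constant.
\<close>

lemma cartier_homog_term:
  fixes U v :: "int poly"
  assumes p: "prime p" and i: "2 * i + 3 \<le> 4 * p" "i \<noteq> p - 1" "i < 2 * p - 1"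
  shows "poly_cong (int p)
    (cartier p (U ^ i * v ^ (4 * p - 3 - 2 * i) * (pderiv U * v - 2 * U * pderiv v))) 0"
    (is "poly_cong _ (cartier p ?T) 0")
proof -
  have p0: "p > 0" using p by (simp add: prime_gt_0_nat)
  define k where "k = 4 * p - 3 - 2 * i"
  have k: "4 * p = k + 2 * i + 3"
    using i by (simp add: k_def)
  have c: "int (Suc k) = 4 * int p - 2 * int (Suc i)"
    using k by simp
  have "pderiv (U ^ Suc i * v ^ Suc k)
      = smult (int (Suc i)) (U ^ i * v ^ Suc k * pderiv U) + smult (int (Suc k)) (U ^ Suc i * v ^ k * pderiv v)"
    by (simp only: pderiv_mult pderiv_power_Suc) (simp add: mult_ac)
  also have "\<dots> = smult (int (Suc i)) ?T + smult (4 * int p) (U ^ Suc i * v ^ k * pderiv v)"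
    unfolding c k_def[symmetric]
    by (simp add: algebra_simps smult_diff_left smult_diff_right numeral_mult_conv_smult smult_add_left)
  finally have "smult (int (Suc i)) ?T
      = pderiv (U ^ Suc i * v ^ Suc k) - smult (4 * int p) (U ^ Suc i * v ^ k * pderiv v)"
    by simp
  from arg_cong[OF this, of "cartier p"]
  have "smult (int (Suc i)) (cartier p ?T)
      = cartier p (pderiv (U ^ Suc i * v ^ Suc k)) - smult (4 * int p) (cartier p (U ^ Suc i * v ^ k * pderiv v))"
    by (simp only: cartier_diff[OF p0] cartier_smult[OF p0])
  moreover have "poly_cong (int p) \<dots> (0 - 0)"
    by (intro poly_cong_diff cartier_pderiv p0)
       (auto simp: poly_cong_iff_coeff cong_0_iff)
  ultimately have "poly_cong (int p) (smult (int (Suc i)) (cartier p ?T)) 0"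
    by simp
  moreover have "coprime (int (Suc i)) (int p)"
  proof -
    have "\<not> p dvd Suc i"
    proof
      assume "p dvd Suc i"
      then obtain m where "Suc i = p * m" by auto
      moreover have "p * m < p * 2" "p * m \<noteq> p * 1" "p * m \<noteq> p * 0"
        using i p0 calculation by linarith+
      then have "m < 2" "m \<noteq> 1" "m \<noteq> 0"
        by auto
      ultimately show False by simp
    qed
    then show ?thesis
      using p by (metis coprime_commute coprime_int_iff prime_imp_coprime_nat)
  qed
  ultimately show ?thesis
    by (auto simp: poly_cong_iff_coeff cong_0_iff coprime_commute coprime_dvd_mult_right_iff
        simp del: of_nat_Suc)
qed

text \<open>
  The hypotheses say that \<open>X = U / v^2\<close>, \<open>Y = y W / v^3\<close> is a map from the curve \<open>y^2 = f(x)\<close> to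
  the curve \<open>Y^2 = X^3 + \<alpha> X^2 + \<beta> X\<close>, and that it pulls the differential \<open>dX / Y\<close>
  back to \<open>dx / y\<close>. The Cartier operator takes each of these differentials to a multiple of
  itself, the factor being the Hasse invariant, and it commutes with the pullback. In polynomial
  form, the proof computes the Cartier operator of \<open>f^n W^p v^p\<close> in two ways.
\<close>

lemma hasse_invariant_isogeny:
  fixes f U v W :: "int poly" and \<alpha> \<beta> :: int
  assumes p: "prime p" "odd p"
    and f: "degree f \<le> 3"
    and monic: "lead_coeff v = 1" "lead_coeff W = 1"
    and curve: "poly_cong (int p)
      (U ^ 3 + smult \<alpha> (U ^ 2 * v ^ 2) + smult \<beta> (U * v ^ 4)) (f * W ^ 2)"
    and normalized: "poly_cong (int p) (pderiv U * v - 2 * U * pderiv v) W"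
  shows "[coeff (f ^ ((p - 1) div 2)) (p - 1)
      = coeff ([:0, \<beta>, \<alpha>, 1:] ^ ((p - 1) div 2)) (p - 1)] (mod int p)"
proof -
  define n where "n = (p - 1) div 2"
  have pn: "p = 2 * n + 1"
    using p by (auto simp: n_def elim!: oddE)
  have p0: "p > 0" using p by (simp add: prime_gt_0_nat)
  define D where "D = pderiv U * v - 2 * U * pderiv v"
  define F where "F = [:0, \<beta>, \<alpha>, 1:]"
  define A where "A = coeff (f ^ n) (p - 1)"
  define B where "B = coeff (F ^ n) (p - 1)"
  define T where "T i = U ^ i * v ^ (4 * p - 3 - 2 * i) * D" for i

  have "degree (f ^ n) \<le> 3 * n"
    using degree_power_le[of f n] f by (meson le_trans mult_le_mono1)
  then have "coeff (f ^ n) (p * j + (p - 1)) = 0" if "j > 0" for j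
  proof -
    have "p * j \<ge> p" using that by simp
    then have "p * j + (p - 1) > 3 * n" using pn by linarith
    then show ?thesis
      using \<open>degree (f ^ n) \<le> 3 * n\<close> by (intro coeff_eq_0) auto
  qed
  then have vanish: "coeff (cartier p (f ^ n)) j = 0" if "j > 0" for j
    using that p0 by (simp only: coeff_cartier)
  have cartier_f: "cartier p (f ^ n) = [:A:]"
  proof (rule poly_eqI)
    show "coeff (cartier p (f ^ n)) j = coeff [:A:] j" for j
      using vanish[of j] p0 by (cases j) (simp_all add: coeff_cartier A_def)
  qed

  \<comment> \<open>Pulling \<open>p\<close>-th powers out of the operator gives \<open>A W v\<close>; substituting the equation of the curve and expanding
      \<open>F^n\<close> leaves only the term with exponent \<open>p - 1\<close>, which gives \<open>B W v\<close>.\<close>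
  have "poly_cong (int p) (smult A (W * v)) (W * (v * cartier p (f ^ n)))"
    by (simp add: cartier_f mult_ac)
  also have "poly_cong (int p) \<dots> (W * cartier p (v ^ p * f ^ n))"
    by (intro poly_cong_mult poly_cong_refl poly_cong_sym[OF cartier_power_mult] p)
  also have "poly_cong (int p) \<dots> (cartier p (W ^ p * (v ^ p * f ^ n)))"
    by (intro poly_cong_sym[OF cartier_power_mult] p)
  also have "W ^ p * (v ^ p * f ^ n) = (f * W ^ 2) ^ n * v ^ p * W"
    by (simp add: pn power_mult_distrib power_add mult_ac flip: power_mult)
  also have "poly_cong (int p) (cartier p \<dots>)
      (cartier p ((U ^ 3 + smult \<alpha> (U ^ 2 * v ^ 2) + smult \<beta> (U * v ^ 4)) ^ n * v ^ p * D))"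
    unfolding D_def
    by (intro cartier_cong p0 poly_cong_mult poly_cong_power poly_cong_refl
        poly_cong_sym[OF curve] poly_cong_sym[OF normalized])
  also have "v ^ 4 = (v ^ 2) ^ 2"
    by simp
  also have "(U ^ 3 + smult \<alpha> (U ^ 2 * v ^ 2) + smult \<beta> (U * (v ^ 2) ^ 2)) ^ n
      = homog (3 * n) (F ^ n) U (v ^ 2)"
    unfolding F_def homog_cubic_power by simp
  also have "homog (3 * n) (F ^ n) U (v ^ 2) * v ^ p * D = (\<Sum>i\<le>3 * n. smult (coeff (F ^ n) i) (T i))"
  proof -
    have "(v ^ 2) ^ (3 * n - i) * v ^ p = v ^ (4 * p - 3 - 2 * i)" if "i \<le> 3 * n" for i
    proof -
      have "4 * p - 3 - 2 * i = 2 * (3 * n - i) + p"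
        using that pn by linarith
      then show ?thesis
        by (simp add: power_add power_mult)
    qed
    then show ?thesis
      unfolding homog_def T_def sum_distrib_right
      by (intro sum.cong refl) (simp add: mult.assoc mult.left_commute[of D])
  qed
  also have "cartier p \<dots> = (\<Sum>i\<le>3 * n. smult (coeff (F ^ n) i) (cartier p (T i)))"
    using p0 by (simp add: cartier_sum cartier_smult)
  also have "poly_cong (int p) \<dots> (\<Sum>i\<le>3 * n. if i = p - 1 then smult B (W * v) else 0)"
  proof (rule poly_cong_sum)
    fix i assume i: "i \<in> {..3 * n}"
    show "poly_cong (int p) (smult (coeff (F ^ n) i) (cartier p (T i)))
        (if i = p - 1 then smult B (W * v) else 0)"
    proof (cases "i = p - 1")
      case False
      have "poly_cong (int p) (cartier p (T i)) 0"
        unfolding T_def D_def using i pn False by (intro cartier_homog_term p) auto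
      then show ?thesis
        using False poly_cong_smult[of "int p" "cartier p (T i)" 0] by simp
    next
      case True
      have e: "4 * p - 3 - 2 * (p - 1) = 2 * p - 1"
        using p0 by linarith
      have vv: "v ^ (2 * p - 1) * v = v ^ p * v ^ p"
        using p0 by (metis power_add power_Suc2 mult_2 Suc_diff_1 nat_0_less_mult_iff zero_less_numeral)
      have v: "v ^ (2 * p - 1) = v ^ p * v ^ (p - 1)"
        using p0 by (metis power_add mult_2 Nat.add_diff_assoc Suc_leI One_nat_def)
      have UU: "U ^ (p - 1) * U = U ^ p"
        using p0 by (metis power_Suc2 Suc_diff_1)
      have "T i = (v ^ (2 * p - 1) * v) * (U ^ (p - 1) * pderiv U)
          - smult 2 ((U ^ (p - 1) * U) * (v ^ (2 * p - 1) * pderiv v))"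
        unfolding T_def D_def True e by (simp add: algebra_simps numeral_mult_conv_smult)
      then have "T i = v ^ p * (v ^ p * (U ^ (p - 1) * pderiv U))
          - smult 2 (U ^ p * (v ^ p * (v ^ (p - 1) * pderiv v)))"
        unfolding vv UU unfolding v by (simp only: mult.assoc)
      then have "cartier p (T i) = cartier p (v ^ p * (v ^ p * (U ^ (p - 1) * pderiv U)))
          - smult 2 (cartier p (U ^ p * (v ^ p * (v ^ (p - 1) * pderiv v))))"
        using p0 by (simp add: cartier_diff cartier_smult)
      also have "poly_cong (int p) \<dots> (v * (v * pderiv U) - smult 2 (U * (v * pderiv v)))"
        using p by (intro poly_cong_diff poly_cong_smult
            poly_cong_trans[OF cartier_power_mult poly_cong_mult] poly_cong_refl cartier_power_pderiv)
      also have "\<dots> = D * v"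
        by (simp add: D_def algebra_simps flip: numeral_mult_conv_smult)
      also have "poly_cong (int p) \<dots> (W * v)"
        unfolding D_def by (intro poly_cong_mult normalized poly_cong_refl)
      finally show ?thesis
        using True by (simp add: B_def poly_cong_smult)
    qed
  qed
  also have "\<dots> = smult B (W * v)"
    using pn by simp
  finally have "[coeff (smult A (W * v)) i = coeff (smult B (W * v)) i] (mod int p)" for i
    by (simp only: poly_cong_iff_coeff)
  from this[of "degree (W * v)"] show ?thesis
    using monic lead_coeff_mult[of W v] by (simp add: A_def B_def F_def n_def)
qed


lemma dvd_imp_poly_cong:
  assumes "f - g = [:c:] * h" "m dvd c"
  shows "poly_cong m f g"
  using assms unfolding poly_cong_def by (metis const_poly_dvd_const_poly_iff dvd_mult2)

text \<open>
  The isogeny given by the formulas of Velu for the subgroup of order \<open>5\<close> of \<open>y^2 = x^3 - r x\<close>,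
  \<open>r^2 = 5\<close>, whose nonzero points have the roots of \<open>v\<close> as their \<open>x\<close>-coordinates. The coordinate
  on the target is shifted so that the image of \<open>(0, 0)\<close> is \<open>(0, 0)\<close>.
\<close>

lemma hasse_invariant_5_isogeny:
  fixes r :: int
  assumes p: "prime p" "odd p" and r: "[r ^ 2 = 5] (mod int p)"
  shows "[coeff ([:0, -r, 0, 1:] ^ ((p - 1) div 2)) (p - 1)
      = coeff ([:0, 360 - 161 * r, 24 * r, 1:] ^ ((p - 1) div 2)) (p - 1)] (mod int p)"
proof -
  define U where "U = [:0, 45 - 20 * r, 110 - 50 * r, 80 - 34 * r, 10 - 6 * r, 1:]"
  define v where "v = [:5 + 2 * r, 5 + r, 1:]"
  define W where "W = [:25 - 10 * r, -25 - 5 * r, 45 + 30 * r, -30 - 30 * r, -15 + 4 * r, 15 + 3 * r, 1:]"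
  have r': "int p dvd r ^ 2 - 5"
    using r by (simp add: cong_iff_dvd_diff)
  show ?thesis
  proof (rule hasse_invariant_isogeny[OF p])
    show "poly_cong (int p) (pderiv U * v - 2 * U * pderiv v) W"
    proof (rule dvd_imp_poly_cong[OF _ r'])
      show "pderiv U * v - 2 * U * pderiv v - W = [:r ^ 2 - 5:] * [:-40, -180, -204, -82, -12:]"
        by (simp add: U_def v_def W_def pderiv_pCons numeral_poly algebra_simps power2_eq_square)
    qed
    show "poly_cong (int p)
      (U ^ 3 + smult (24 * r) (U ^ 2 * v ^ 2) + smult (360 - 161 * r) (U * v ^ 4)) ([:0, -r, 0, 1:] * W ^ 2)"
    proof (rule dvd_imp_poly_cong[OF _ r'])
      show "U ^ 3 + smult (24 * r) (U ^ 2 * v ^ 2) + smult (360 - 161 * r) (U * v ^ 4)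
          - [:0, -r, 0, 1:] * W ^ 2 = [:r ^ 2 - 5:] *
          [:0,
            -2025000 - 1434500 * r + 137600 * r ^ 2 + 284080 * r ^ 3 + 51520 * r ^ 4,
            -13050000 - 7816500 * r + 1464800 * r ^ 2 + 1580800 * r ^ 3 + 231840 * r ^ 4,
            -37188100 - 18381125 * r + 5310480 * r ^ 2 + 3697160 * r ^ 3 + 422464 * r ^ 4,
            -61603900 - 24143100 * r + 10120480 * r ^ 2 + 4840520 * r ^ 3 + 409584 * r ^ 4,
            -65799325 - 19190075 * r + 11697700 * r ^ 2 + 3929067 * r ^ 3 + 229908 * r ^ 4,
            -47644300 - 9193550 * r + 8722350 * r ^ 2 + 2053218 * r ^ 3 + 75026 * r ^ 4,
            -23990460 - 2261190 * r + 4294094 * r ^ 2 + 690624 * r ^ 3 + 13202 * r ^ 4,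
            -8489580 + 40030 * r + 1384170 * r ^ 2 + 144110 * r ^ 3 + 966 * r ^ 4,
            -2103150 + 201685 * r + 278520 * r ^ 2 + 16951 * r ^ 3,
            -358780 + 54248 * r + 31168 * r ^ 2 + 864 * r ^ 3,
            -42504 + 5187 * r + 1440 * r ^ 2,
            -3488 + 96 * r,
            -141:]"
        by (simp add: U_def v_def W_def power2_eq_square power3_eq_cube power4_eq_xxxx algebra_simps)
    qed
  qed (simp_all add: v_def W_def)
qed

section \<open>Legendre symbols and power sums\<close>

lemma dvd_abs_less_imp_eq_0:
  fixes t m :: int
  assumes "m dvd t" "\<bar>t\<bar> < m"
  shows "t = 0"
  using dvd_imp_le_int[of t m] assms by (cases "t = 0") auto

text \<open>
  Summing \<open>(x + 1)^(k + 1) - x^(k + 1)\<close> over \<open>x < p\<close> telescopes to \<open>p^(k + 1)\<close>, and expanding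
  gives \<open>k + 1\<close> times the sum of \<open>k\<close>-th powers modulo the sums of lower powers.
\<close>

lemma sum_powers_cong_0:
  assumes "prime p" "k < p - 1"
  shows "[(\<Sum>x<p. int x ^ k) = 0] (mod int p)"
  using assms(2)
proof (induction k rule: less_induct)
  case (less k)
  have tele: "(\<Sum>x<m. int (Suc x) ^ Suc k - int x ^ Suc k) = int m ^ Suc k" for m
    by (induction m) simp_all
  have "int (Suc x) ^ Suc k - int x ^ Suc k = (\<Sum>i\<le>k. int (Suc k choose i) * int x ^ i)" for x
    using binomial_ring[of "int x" 1 "Suc k"] by (simp add: add.commute)
  then have "int p ^ Suc k = (\<Sum>x<p. \<Sum>i\<le>k. int (Suc k choose i) * int x ^ i)"
    using tele[of p] by simp
  also have "\<dots> = (\<Sum>i\<le>k. int (Suc k choose i) * (\<Sum>x<p. int x ^ i))"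
    by (subst sum.swap) (simp add: sum_distrib_left)
  also have "\<dots> = (\<Sum>i<k. int (Suc k choose i) * (\<Sum>x<p. int x ^ i)) + int (Suc k) * (\<Sum>x<p. int x ^ k)"
    by (simp add: lessThan_Suc_atMost[symmetric])
  finally have "int (Suc k) * (\<Sum>x<p. int x ^ k)
      = int p ^ Suc k - (\<Sum>i<k. int (Suc k choose i) * (\<Sum>x<p. int x ^ i))"
    by simp
  moreover have "int p dvd (\<Sum>i<k. int (Suc k choose i) * (\<Sum>x<p. int x ^ i))"
    using less by (intro dvd_sum[where A = "{..<k}"] dvd_mult) (simp add: cong_0_iff)
  then have "int p dvd int p ^ Suc k - (\<Sum>i<k. int (Suc k choose i) * (\<Sum>x<p. int x ^ i))"
    by (intro dvd_diff) simp_all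
  ultimately have "int p dvd int (Suc k) * (\<Sum>x<p. int x ^ k)"
    by simp
  moreover have "coprime (int p) (int (Suc k))"
    using coprime_int_less_prime[OF assms(1), of "Suc k"] less.prems by (simp add: coprime_commute)
  ultimately show ?case
    by (simp add: coprime_dvd_mult_right_iff cong_0_iff del: of_nat_Suc)
qed

lemma sum_powers_cong:
  assumes "prime p" "k < 2 * p - 2"
  shows "[(\<Sum>x<p. int x ^ k) = (if k = p - 1 then -1 else 0)] (mod int p)"
proof (cases "k < p - 1")
  case True
  then show ?thesis using sum_powers_cong_0[OF assms(1)] by simp
next
  case False
  have p: "p > 1" using assms(1) by (rule prime_gt_1_nat)
  have fermat: "[int x ^ (p - 1) = 1] (mod int p)" if "x \<in> {1..<p}" for x
    using that assms(1) by (intro fermat_theorem_int) (auto dest: zdvd_not_zless)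
  have split: "(\<Sum>x<p. f x) = f 0 + (\<Sum>x\<in>{1..<p}. f x)" for f :: "nat \<Rightarrow> int"
    using p by (simp add: lessThan_atLeast0 sum.atLeast_Suc_lessThan)
  show ?thesis
  proof (cases "k = p - 1")
    case True
    have "[(\<Sum>x\<in>{1..<p}. int x ^ k) = (\<Sum>x\<in>{1..<p}. 1)] (mod int p)"
      unfolding True by (rule cong_sum) (rule fermat)
    then have "[(\<Sum>x<p. int x ^ k) = int p - 1] (mod int p)"
      using True p by (simp add: split of_nat_diff power_0_left)
    also have "[int p - 1 = -1] (mod int p)"
      by (simp add: cong_iff_dvd_diff)
    finally show ?thesis
      using True by simp
  next
    case neq: False
    define j where "j = k - (p - 1)"
    have j: "k = (p - 1) + j" "0 < j" "j < p - 1"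
      using False neq assms(2) by (auto simp: j_def)
    have "[(\<Sum>x<p. int x ^ k) = (\<Sum>x<p. int x ^ j)] (mod int p)"
    proof (rule cong_sum)
      fix x assume "x \<in> {..<p}"
      then show "[int x ^ k = int x ^ j] (mod int p)"
        using cong_mult[OF fermat[of x] cong_refl[of "int x ^ j"]] j(2)
        unfolding j(1) power_add by (cases "x = 0") (auto simp: power_0_left)
    qed
    also have "[(\<Sum>x<p. int x ^ j) = 0] (mod int p)"
      using sum_powers_cong_0[OF assms(1) j(3)] .
    finally show ?thesis
      using neq by simp
  qed
qed

lemma sum_poly_cong:
  fixes f :: "int poly"
  assumes "prime p" "degree f < 2 * p - 2"
  shows "[(\<Sum>x<p. poly f (int x)) = - coeff f (p - 1)] (mod int p)"
proof -
  have "(\<Sum>x<p. poly f (int x)) = (\<Sum>x<p. \<Sum>i<2 * p - 2. coeff f i * int x ^ i)"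
    unfolding poly_altdef using assms(2)
    by (intro sum.cong sum.mono_neutral_left) (auto simp: coeff_eq_0)
  also have "\<dots> = (\<Sum>i<2 * p - 2. coeff f i * (\<Sum>x<p. int x ^ i))"
    by (subst sum.swap) (simp add: sum_distrib_left)
  also have "[\<dots> = (\<Sum>i<2 * p - 2. coeff f i * (if i = p - 1 then -1 else 0))] (mod int p)"
    using sum_powers_cong[OF assms(1)] by (intro cong_sum cong_mult cong_refl) auto
  also have "(\<Sum>i<2 * p - 2. coeff f i * (if i = p - 1 then -1 else 0))
      = (\<Sum>i<2 * p - 2. if i = p - 1 then - coeff f (p - 1) else 0)"
    by (intro sum.cong) auto
  also have "\<dots> = - coeff f (p - 1)"
    using prime_gt_1_nat[OF assms(1)] by simp
  finally show ?thesis .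
qed

lemma Legendre_values: "Legendre a m \<in> {-1, 0, 1}"
  by (simp add: Legendre_def)

lemma Legendre_eq_0_iff: "Legendre a (int p) = 0 \<longleftrightarrow> int p dvd a"
  by (simp add: Legendre_def cong_0_iff)

lemma Legendre_cong: "[a = b] (mod m) \<Longrightarrow> Legendre a m = Legendre b m"
proof -
  assume *: "[a = b] (mod m)"
  have "QuadRes m a = QuadRes m b"
    unfolding QuadRes_def using * by (meson cong_sym cong_trans)
  moreover have "[a = 0] (mod m) = [b = 0] (mod m)"
    using * by (meson cong_sym cong_trans)
  ultimately show ?thesis
    by (simp add: Legendre_def)
qed

lemma Legendre_eqI:
  assumes "2 < p" "[Legendre a (int p) = b] (mod int p)" "b \<in> {-1, 0, 1}"
  shows "Legendre a (int p) = b"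
  using cong_less_imp_eq_int[of "Legendre a (int p) + 1" "int p" "b + 1"] assms
    Legendre_values[of a "int p"] cong_add[OF assms(2) cong_refl[of 1]]
  by auto

lemma Legendre_mult:
  assumes "prime p" "2 < p"
  shows "Legendre (a * b) (int p) = Legendre a (int p) * Legendre b (int p)"
proof (rule Legendre_eqI[OF assms(2)])
  have "[Legendre (a * b) (int p) = a ^ ((p - 1) div 2) * b ^ ((p - 1) div 2)] (mod int p)"
    using euler_criterion[OF assms, of "a * b"] by (simp add: power_mult_distrib)
  also have "[a ^ ((p - 1) div 2) * b ^ ((p - 1) div 2) = Legendre a (int p) * Legendre b (int p)] (mod int p)"
    by (intro cong_mult cong_sym[OF euler_criterion[OF assms]])
  finally show "[Legendre (a * b) (int p) = Legendre a (int p) * Legendre b (int p)] (mod int p)" .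
  show "Legendre a (int p) * Legendre b (int p) \<in> {-1, 0, 1}"
    using Legendre_values[of a "int p"] Legendre_values[of b "int p"] by auto
qed

lemma Legendre_square:
  assumes "prime p" "2 < p" "\<not> int p dvd a"
  shows "Legendre (a\<^sup>2) (int p) = 1"
  using Legendre_mult[OF assms(1,2), of a a] Legendre_values[of a "int p"] Legendre_eq_0_iff[of a p] assms(3)
  by (auto simp: power2_eq_square)

lemma Legendre_minus_one:
  assumes "prime p" "2 < p"
  shows "Legendre (-1) (int p) = (-1) ^ ((p - 1) div 2)"
proof (rule Legendre_eqI[OF assms(2)])
  show "[Legendre (-1) (int p) = (-1) ^ ((p - 1) div 2)] (mod int p)"
    by (rule euler_criterion[OF assms])
  show "(-1) ^ ((p - 1) div 2) \<in> {-1, 0, 1 :: int}"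
    using neg_one_even_power neg_one_odd_power by (cases "even ((p - 1) div 2)") auto
qed

lemma abs_Legendre_le_1: "\<bar>Legendre a m\<bar> \<le> 1"
  by (simp add: Legendre_def)

lemma sum_Legendre_poly_cong:
  assumes "prime p" "2 < p" "degree f < 4"
  shows "[(\<Sum>x<p. Legendre (poly f (int x)) (int p)) = - coeff (f ^ ((p - 1) div 2)) (p - 1)] (mod int p)"
proof -
  define n where "n = (p - 1) div 2"
  have n: "p = 2 * n + 1" "n > 0"
    using assms prime_odd_nat[OF assms(1)] by (auto simp: n_def elim!: oddE)
  have "[(\<Sum>x<p. Legendre (poly f (int x)) (int p)) = (\<Sum>x<p. poly (f ^ n) (int x))] (mod int p)"
    using euler_criterion[OF assms(1,2)] by (intro cong_sum) (simp add: n_def)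
  also have "degree (f ^ n) \<le> 3 * n"
    using degree_power_le[of f n] mult_le_mono1[of "degree f" 3 n] assms(3) by linarith
  then have "[(\<Sum>x<p. poly (f ^ n) (int x)) = - coeff (f ^ n) (p - 1)] (mod int p)"
    using n by (intro sum_poly_cong assms(1)) auto
  finally show ?thesis
    by (simp add: n_def)
qed

lemma sum_Legendre:
  assumes "prime p" "2 < p"
  shows "(\<Sum>x<p. Legendre (int x) (int p)) = 0"
proof -
  define n where "n = (p - 1) div 2"
  have n: "p = 2 * n + 1" "n > 0"
    using assms prime_odd_nat[OF assms(1)] by (auto simp: n_def elim!: oddE)
  have "[:0, 1 :: int:] ^ n = monom 1 n"
    by (simp add: monom_altdef)
  then have "coeff ([:0, 1 :: int:] ^ n) (p - 1) = 0"
    using n by simp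
  then have "int p dvd (\<Sum>x<p. Legendre (int x) (int p))"
    using sum_Legendre_poly_cong[OF assms, of "[:0, 1:]"] by (simp add: n_def cong_0_iff)
  moreover have "\<bar>\<Sum>x<p. Legendre (int x) (int p)\<bar> < int p"
  proof -
    have "(\<Sum>x<p. Legendre (int x) (int p)) = (\<Sum>x\<in>{1..<p}. Legendre (int x) (int p))"
      using assms(2) by (intro sum.mono_neutral_right) (auto simp: Legendre_eq_0_iff not_less_eq_eq)
    also have "\<bar>\<dots>\<bar> \<le> (\<Sum>x\<in>{1..<p}. 1)"
      by (rule sum_abs[THEN order_trans]) (intro sum_mono abs_Legendre_le_1)
    finally show ?thesis
      using assms(2) by simp
  qed
  ultimately show ?thesis
    by (rule dvd_abs_less_imp_eq_0)
qed

text \<open>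
  The sum is \<open>-1\<close> modulo \<open>p\<close>, and its size decides which of the two possible values it has.
\<close>

lemma sum_Legendre_two_linear:
  assumes "prime p" "2 < p"
  shows "(\<Sum>x<p. Legendre ((int x + a) * (int x + b)) (int p))
    = (if [a = b] (mod int p) then int p - 1 else -1)" (is "?T = _")
proof -
  define n where "n = (p - 1) div 2"
  have n: "p = 2 * n + 1" "n > 0"
    using assms prime_odd_nat[OF assms(1)] by (auto simp: n_def elim!: oddE)
  define f where "f = [:a * b, a + b, 1:]"
  have "degree (f ^ n) = 2 * n"
    by (simp add: f_def degree_power_eq)
  moreover have "lead_coeff (f ^ n) = 1"
    by (simp only: lead_coeff_power) (simp add: f_def)
  ultimately have "coeff (f ^ n) (p - 1) = 1"
    unfolding n by (metis diff_add_inverse2)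
  moreover have "poly f x = (x + a) * (x + b)" for x
    by (simp add: f_def algebra_simps)
  ultimately have cong: "[?T = -1] (mod int p)"
    using sum_Legendre_poly_cong[OF assms, of f] by (simp add: n_def f_def)
  \<comment> \<open>The residue below \<open>p\<close> at which the linear factor \<open>X + c\<close> vanishes.\<close>
  define z where "z c = nat ((- c) mod int p)" for c
  have z: "z c < p" "int p dvd int (z c) + c" for c
    using assms(2) by (auto simp: z_def nat_less_iff mod_0_imp_dvd mod_add_left_eq)
  show ?thesis
  proof (cases "[a = b] (mod int p)")
    case True
    have "Legendre ((int x + a) * (int x + b)) (int p) = Legendre ((int x + a)\<^sup>2) (int p)" for x
      unfolding power2_eq_square
      by (intro Legendre_cong cong_mult cong_add cong_refl cong_sym[OF True])
    moreover have "Legendre ((int x + a)\<^sup>2) (int p) \<in> {0, 1}" for x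
      using Legendre_square[OF assms, of "int x + a"] Legendre_eq_0_iff[of "(int x + a)\<^sup>2" p]
      by (cases "int p dvd int x + a") (auto simp: power2_eq_square)
    ultimately have L: "Legendre ((int x + a) * (int x + b)) (int p) \<in> {0, 1}" for x
      by simp
    have "0 \<le> ?T"
    proof (rule sum_nonneg)
      show "0 \<le> Legendre ((int x + a) * (int x + b)) (int p)" for x
        using L[of x] by auto
    qed
    moreover have "?T \<le> (\<Sum>x<p. 1)"
    proof (rule sum_mono)
      show "Legendre ((int x + a) * (int x + b)) (int p) \<le> 1" for x
        using L[of x] by auto
    qed
    moreover have "int p dvd ?T + 1"
      using cong by (simp add: cong_iff_dvd_diff)
    moreover have "t + 1 = int p" if "0 \<le> t" "t \<le> int p" "int p dvd t + 1" for t
    proof -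
      from that(3) obtain m where m: "t + 1 = int p * m" ..
      have "int p > 2"
        using assms(2) by simp
      have "m < 2"
      proof (rule ccontr)
        assume "\<not> m < 2"
        then have "int p * 2 \<le> int p * m"
          by (intro mult_left_mono) auto
        with m that(2) \<open>int p > 2\<close> show False by linarith
      qed
      moreover have "m > 0"
      proof (rule ccontr)
        assume "\<not> m > 0"
        then have "int p * m \<le> 0"
          by (intro mult_nonneg_nonpos) auto
        with m that(1) show False by linarith
      qed
      ultimately have "m = 1" by simp
      then show ?thesis using m by simp
    qed
    ultimately have "?T + 1 = int p"
      by (simp only: sum_constant card_lessThan mult_1_right)
    then show ?thesis
      using True by simp
  next
    case False
    have "z a \<noteq> z b"
    proof
      assume "z a = z b"
      then have "int p dvd (int (z a) + a) - (int (z a) + b)"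
        using z(2)[of a] z(2)[of b] by (metis dvd_diff)
      then show False
        using False by (simp add: cong_iff_dvd_diff)
    qed
    have "?T = (\<Sum>x\<in>{..<p} - {z a, z b}. Legendre ((int x + a) * (int x + b)) (int p))"
      using z by (intro sum.mono_neutral_right) (auto simp: Legendre_eq_0_iff)
    also have "\<bar>\<dots>\<bar> \<le> (\<Sum>x\<in>{..<p} - {z a, z b}. 1)"
      by (rule sum_abs[THEN order_trans]) (intro sum_mono abs_Legendre_le_1)
    also have "\<dots> = int p - 2"
      using z \<open>z a \<noteq> z b\<close> assms(2) by (simp add: card_Diff_subset of_nat_diff)
    finally have "\<bar>?T + 1\<bar> < int p"
      by simp
    moreover have "int p dvd ?T + 1"
      using cong by (simp add: cong_iff_dvd_diff)
    ultimately have "?T + 1 = 0"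
      by (intro dvd_abs_less_imp_eq_0)
    then show ?thesis
      using False by simp
  qed
qed



section \<open>Jacobsthal sums\<close>

text \<open>
  The Jacobsthal sum: minus the trace of Frobenius of the curve \<open>y^2 = x^3 + D x\<close>, if \<open>p\<close> does not
  divide \<open>D\<close>.
\<close>

definition jacobsthal :: "nat \<Rightarrow> int \<Rightarrow> int" where
  "jacobsthal p D = (\<Sum>x<p. Legendre (int x * ((int x)\<^sup>2 + D)) (int p))"

text \<open>
  A prime \<open>p = 2 n + 1\<close> congruent to \<open>1\<close> modulo \<open>4\<close>.
\<close>

locale prime_1_mod_4 =
  fixes p n :: nat
  assumes prime: "prime p" and p_eq: "p = 2 * n + 1" and even_n: "even n" and n_pos: "n > 0"
begin

abbreviation chi :: "int \<Rightarrow> int" where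
  "chi a \<equiv> Legendre a (int p)"

lemma p_gt_2: "2 < p"
  using p_eq n_pos by linarith

lemma n_eq: "(p - 1) div 2 = n" "(p - Suc 0) div 2 = n"
  using p_eq by simp_all

lemmas chi_mult = Legendre_mult[OF prime p_gt_2]
lemmas chi_square = Legendre_square[OF prime p_gt_2]
lemmas chi_0_iff = Legendre_eq_0_iff[of _ p]

lemma chi_minus: "chi (- a) = chi a"
  using chi_mult[of "-1" a] Legendre_minus_one[OF prime p_gt_2] even_n by (simp add: n_eq)

lemma chi_power: "[chi a = a ^ n] (mod int p)"
  using euler_criterion[OF prime p_gt_2, of a] by (simp add: n_eq)

lemma jacobsthal_cong:
  "[jacobsthal p D = - (int (n choose (n div 2)) * D ^ (n div 2))] (mod int p)"
proof -
  have "[jacobsthal p D = - coeff ([:0, D, 0, 1:] ^ n) (p - 1)] (mod int p)"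
    using sum_Legendre_poly_cong[OF prime p_gt_2, of "[:0, D, 0, 1:]"]
    by (simp add: n_eq jacobsthal_def algebra_simps power2_eq_square)
  also have "coeff ([:0, D, 0, 1:] ^ n) (p - 1)
      = (\<Sum>k\<le>n div 2. if k = n div 2 then int (n choose n) * int (n choose (n div 2)) * D ^ (n div 2) else 0)"
    unfolding p_eq using even_n hasse_invariant_2_torsion[of D 0 n]
    by (simp del: sum.delta) (intro sum.cong; auto simp: power_0_left elim!: evenE)
  also have "\<dots> = int (n choose (n div 2)) * D ^ (n div 2)"
    by simp
  finally show ?thesis .
qed

lemma jacobsthal_half: "jacobsthal p D = 2 * (\<Sum>x\<in>{1..n}. chi (int x * ((int x)\<^sup>2 + D)))"
proof -
  define h where "h x = chi (int x * ((int x)\<^sup>2 + D))" for x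
  have h_reflect: "h (p - x) = h x" if "x \<le> p" for x
  proof -
    have "[int (p - x) * ((int (p - x))\<^sup>2 + D) = (- int x) * ((- int x)\<^sup>2 + D)] (mod int p)"
      using that by (intro cong_mult cong_add cong_pow cong_refl) (auto simp: cong_iff_dvd_diff of_nat_diff)
    then show ?thesis
      using Legendre_cong[of _ _ "int p"] chi_minus unfolding h_def by (metis mult_minus_left power2_minus)
  qed
  have "{..<p} = insert 0 ({1..n} \<union> {n + 1..2 * n})"
    using p_eq by auto
  then have "jacobsthal p D = h 0 + (sum h {1..n} + sum h {n + 1..2 * n})"
    unfolding jacobsthal_def h_def[symmetric] by (simp add: sum.union_disjoint)
  moreover have "h 0 = 0"
    by (simp add: h_def Legendre_def)
  moreover have "sum h {n + 1..2 * n} = sum h {1..n}"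
    by (rule sum.reindex_bij_witness[of _ "\<lambda>x. p - x" "\<lambda>x. p - x"]) (auto simp: p_eq h_reflect[unfolded p_eq, simplified])
  ultimately show ?thesis
    by (simp add: h_def)
qed

lemma abs_jacobsthal_half: "\<bar>\<Sum>x\<in>{1..n}. chi (int x * ((int x)\<^sup>2 + D))\<bar> \<le> int n"
proof -
  have "\<bar>\<Sum>x\<in>{1..n}. chi (int x * ((int x)\<^sup>2 + D))\<bar> \<le> (\<Sum>x\<in>{1..n}. 1)"
    by (rule sum_abs[THEN order_trans]) (intro sum_mono abs_Legendre_le_1)
  then show ?thesis by simp
qed

lemma jacobsthal_0: "jacobsthal p 0 = 0"
proof -
  have "chi (int x * ((int x)\<^sup>2 + 0)) = chi (int x)" for x
    using chi_mult[of "int x" "(int x)\<^sup>2"] chi_square[of "int x"] chi_0_iff[of "int x"]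
    by (cases "int p dvd int x") auto
  then show ?thesis
    unfolding jacobsthal_def using sum_Legendre[OF prime p_gt_2] by simp
qed

text \<open>
  Up to sign, the Jacobsthal sum depends only on the quadratic character of its parameter. Modulo
  \<open>p\<close> this follows from \<open>jacobsthal_cong\<close>; as both sums are even and at most \<open>p - 1\<close> in absolute
  value, it holds exactly.
\<close>

lemma jacobsthal_square_eq:
  assumes "chi D = chi E"
  shows "(jacobsthal p D)\<^sup>2 = (jacobsthal p E)\<^sup>2"
proof -
  define s where "s D = (\<Sum>x\<in>{1..n}. chi (int x * ((int x)\<^sup>2 + D)))" for D
  have S: "jacobsthal p D = 2 * s D" for D
    by (simp add: s_def jacobsthal_half)
  have sq: "[(jacobsthal p D)\<^sup>2 = (int (n choose (n div 2)))\<^sup>2 * chi D] (mod int p)" for D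
  proof -
    have "[(jacobsthal p D)\<^sup>2 = (- (int (n choose (n div 2)) * D ^ (n div 2)))\<^sup>2] (mod int p)"
      by (intro cong_pow jacobsthal_cong)
    also have "(- (int (n choose (n div 2)) * D ^ (n div 2)))\<^sup>2 = (int (n choose (n div 2)))\<^sup>2 * D ^ n"
      using even_n by (simp add: power_mult_distrib flip: power_mult)
    also have "[\<dots> = (int (n choose (n div 2)))\<^sup>2 * chi D] (mod int p)"
      by (intro cong_mult cong_refl cong_sym[OF chi_power])
    finally show ?thesis .
  qed
  have "[(jacobsthal p D)\<^sup>2 = (jacobsthal p E)\<^sup>2] (mod int p)"
    using sq[of D] sq[of E] assms by (metis cong_sym cong_trans)
  then have "int p dvd 4 * ((s D - s E) * (s D + s E))"
    unfolding S cong_iff_dvd_diff by (simp add: power2_eq_square algebra_simps)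
  moreover have "coprime (int p) 4"
    using coprime_power_right_iff[of "int p" 2 2] prime p_eq by (simp add: coprime_right_2_iff_odd)
  ultimately have "int p dvd (s D - s E) * (s D + s E)"
    by (simp add: coprime_dvd_mult_right_iff)
  then have "int p dvd s D - s E \<or> int p dvd s D + s E"
    using prime by (simp add: prime_dvd_mult_iff)
  moreover have "\<bar>s D - s E\<bar> < int p" "\<bar>s D + s E\<bar> < int p"
    using abs_jacobsthal_half[of D] abs_jacobsthal_half[of E] p_eq unfolding s_def[symmetric] by linarith+
  ultimately have "s D - s E = 0 \<or> s D + s E = 0"
    using dvd_abs_less_imp_eq_0 by blast
  then have "s D = s E \<or> s D = - s E"
    by linarith
  then show ?thesis
    unfolding S by auto
qed

text \<open>
  Expand the squares and sum over \<open>D\<close> first, using \<open>sum_Legendre_two_linear\<close>.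
\<close>

lemma sum_jacobsthal_square: "(\<Sum>D<p. (jacobsthal p (int D))\<^sup>2) = 2 * int p * (int p - 1)"
proof -
  have cong_sq: "[(int x)\<^sup>2 = (int y)\<^sup>2] (mod int p) \<longleftrightarrow> y = x \<or> y = p - x" if "x \<in> {1..<p}" "y < p" for x y
  proof -
    have "[(int x)\<^sup>2 = (int y)\<^sup>2] (mod int p) \<longleftrightarrow> int p dvd (int x - int y) * (int x + int y)"
      by (simp add: cong_iff_dvd_diff power2_eq_square algebra_simps)
    also have "\<dots> \<longleftrightarrow> int p dvd int x - int y \<or> int p dvd int x + int y"
      using prime by (simp add: prime_dvd_mult_iff)
    also have "int p dvd int x - int y \<longleftrightarrow> y = x"
      using dvd_abs_less_imp_eq_0[of "int p" "int x - int y"] that by auto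
    also have "int p dvd int x + int y \<longleftrightarrow> y = p - x"
    proof
      assume "int p dvd int x + int y"
      then have "int p dvd int x + int y - int p"
        by simp
      moreover have "\<bar>int x + int y - int p\<bar> < int p"
        using that by auto
      ultimately have "int x + int y - int p = 0"
        by (rule dvd_abs_less_imp_eq_0)
      then show "y = p - x" by linarith
    qed (use that in \<open>auto simp: of_nat_diff\<close>)
    finally show ?thesis .
  qed
  define I :: "nat \<Rightarrow> nat \<Rightarrow> int" where "I x y = (if [(int x)\<^sup>2 = (int y)\<^sup>2] (mod int p) then 1 else 0)" for x y
  have T: "(\<Sum>D<p. chi ((int D + (int x)\<^sup>2) * (int D + (int y)\<^sup>2))) = int p * I x y - 1" for x y
    using sum_Legendre_two_linear[OF prime p_gt_2, of "(int x)\<^sup>2" "(int y)\<^sup>2"] by (simp add: I_def)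
  have inner: "(\<Sum>y<p. chi (int x) * chi (int y) * I x y) = (if x = 0 then 0 else 2)" if "x < p" for x
  proof (cases "x = 0")
    case True
    then show ?thesis by (simp add: Legendre_def)
  next
    case False
    then have x: "x \<in> {1..<p}" using that by simp
    have "x \<noteq> p - x"
      using p_eq x by presburger
    have nd: "\<not> int p dvd int x"
      using x by (auto dest: zdvd_not_zless)
    have "chi (int (p - x)) = chi (- int x)"
      using that by (intro Legendre_cong) (simp add: cong_iff_dvd_diff of_nat_diff)
    then have eq: "chi (int (p - x)) = chi (int x)"
      by (simp add: chi_minus)
    have one: "chi (int x) * chi (int x) = 1"
      using chi_square[OF nd] by (simp add: power2_eq_square chi_mult)
    have "(\<Sum>y<p. chi (int x) * chi (int y) * I x y) = (\<Sum>y\<in>{x, p - x}. chi (int x) * chi (int y) * I x y)"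
      using x cong_sq[OF x] by (intro sum.mono_neutral_right) (auto simp: I_def)
    also have "\<dots> = chi (int x) * chi (int x) * I x x + chi (int x) * chi (int (p - x)) * I x (p - x)"
      using \<open>x \<noteq> p - x\<close> by simp
    also have "\<dots> = 2"
    proof -
      have "I x x = 1" "I x (p - x) = 1"
        using x cong_sq[OF x, of x] cong_sq[OF x, of "p - x"] unfolding I_def by auto
      then show ?thesis
        unfolding eq one by simp
    qed
    finally show ?thesis
      using False by simp
  qed
  have "(\<Sum>D<p. (jacobsthal p (int D))\<^sup>2)
      = (\<Sum>D<p. \<Sum>x<p. \<Sum>y<p. chi (int x) * chi (int y) * chi ((int D + (int x)\<^sup>2) * (int D + (int y)\<^sup>2)))"
    by (simp add: jacobsthal_def power2_eq_square sum_product chi_mult mult_ac add.commute)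
  also have "\<dots> = (\<Sum>x<p. \<Sum>y<p. \<Sum>D<p. chi (int x) * chi (int y) * chi ((int D + (int x)\<^sup>2) * (int D + (int y)\<^sup>2)))"
    by (subst sum.swap) (intro sum.cong refl sum.swap)
  also have "\<dots> = (\<Sum>x<p. \<Sum>y<p. int p * (chi (int x) * chi (int y) * I x y) - chi (int x) * chi (int y))"
    by (intro sum.cong refl) (simp only: sum_distrib_left[symmetric] T, simp add: algebra_simps)
  also have "\<dots> = int p * (\<Sum>x<p. \<Sum>y<p. chi (int x) * chi (int y) * I x y)
      - (\<Sum>x<p. chi (int x)) * (\<Sum>y<p. chi (int y))"
    unfolding sum_product by (simp add: sum_subtractf sum_distrib_left)
  also have "(\<Sum>x<p. \<Sum>y<p. chi (int x) * chi (int y) * I x y) = (\<Sum>x<p. if x = 0 then 0 else 2)"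
    using inner by (intro sum.cong) auto
  also have "\<dots> = (\<Sum>x\<in>{1..<p}. 2)"
    by (intro sum.mono_neutral_cong_right) auto
  finally show ?thesis
    using sum_Legendre[OF prime p_gt_2] p_gt_2 by (simp add: of_nat_diff algebra_simps)
qed

lemma ex_nonresidue: "\<exists>g. chi g = -1"
proof (rule ccontr)
  assume "\<nexists>g. chi g = -1"
  then have "chi (int x) \<ge> 0" for x
    using Legendre_values[of "int x" "int p"] by force
  moreover have "chi (int 1) = 1"
    using chi_square[of 1] p_gt_2 by simp
  ultimately have "(\<Sum>x<p. chi (int x)) \<ge> chi (int 1)"
    using p_gt_2 by (intro member_le_sum) auto
  then show False
    using sum_Legendre[OF prime p_gt_2] \<open>chi (int 1) = 1\<close> by simp
qed

lemma jacobsthal_two_squares: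
  assumes g: "chi g = -1"
  shows "(jacobsthal p 1)\<^sup>2 + (jacobsthal p g)\<^sup>2 = 4 * int p"
proof -
  have one: "chi 1 = 1"
    using chi_square[of 1] p_gt_2 by simp
  let ?A = "(jacobsthal p 1)\<^sup>2" and ?B = "(jacobsthal p g)\<^sup>2"
  have "2 * (\<Sum>D<p. (jacobsthal p (int D))\<^sup>2) = (\<Sum>D\<in>{1..<p}. 2 * (jacobsthal p (int D))\<^sup>2)"
    unfolding sum_distrib_left using jacobsthal_0
    by (intro sum.mono_neutral_right) (auto simp: not_less_eq_eq)
  also have "\<dots> = (\<Sum>D\<in>{1..<p}. (?A + ?B) + chi (int D) * (?A - ?B))"
  proof (intro sum.cong refl)
    fix D assume "D \<in> {1..<p}"
    then have "chi (int D) \<noteq> 0"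
      by (auto simp: chi_0_iff dest: zdvd_not_zless)
    then consider "chi (int D) = chi 1" | "chi (int D) = chi g"
      using Legendre_values[of "int D" "int p"] one g by auto
    then show "2 * (jacobsthal p (int D))\<^sup>2 = (?A + ?B) + chi (int D) * (?A - ?B)"
      using jacobsthal_square_eq[of "int D" 1] jacobsthal_square_eq[of "int D" g] one g by cases auto
  qed
  also have "\<dots> = (int p - 1) * (?A + ?B) + (\<Sum>D\<in>{1..<p}. chi (int D)) * (?A - ?B)"
    using p_gt_2 by (simp add: sum.distrib sum_distrib_right of_nat_diff)
  also have "(\<Sum>D\<in>{1..<p}. chi (int D)) = (\<Sum>D<p. chi (int D))"
    using p_gt_2 by (intro sum.mono_neutral_left) (auto simp: chi_0_iff not_less_eq_eq)
  finally have "(int p - 1) * (?A + ?B) = (int p - 1) * (4 * int p)"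
    unfolding sum_jacobsthal_square sum_Legendre[OF prime p_gt_2] by (simp add: algebra_simps)
  then show ?thesis
    using p_gt_2 by simp
qed

text \<open>
  All terms are odd, except the one at the square root of \<open>-1\<close> between \<open>1\<close> and \<open>n\<close>, which is zero.
\<close>

lemma jacobsthal_half_odd: "odd (\<Sum>x\<in>{1..n}. chi (int x * ((int x)\<^sup>2 + 1)))"
proof -
  have "chi (-1) = 1"
    using Legendre_minus_one[OF prime p_gt_2] even_n by (simp add: n_eq)
  then have "QuadRes (int p) (-1)"
    by (simp add: Legendre_def split: if_splits)
  then obtain f where f: "int p dvd f\<^sup>2 + 1"
    by (auto simp: QuadRes_def cong_iff_dvd_diff)
  define m where "m = nat (f mod int p)"
  have m: "int m = f mod int p" "m < p"
    using p_gt_2 by (simp_all add: m_def nat_less_iff)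
  then have mf: "int p dvd f - int m"
    by (simp only: m(1) dvd_minus_mod)
  define i where "i = (if m \<le> n then m else p - m)"
  have i2: "int p dvd (int i)\<^sup>2 + 1"
  proof -
    have "[int i = f] (mod int p) \<or> [int i = - f] (mod int p)"
    proof (cases "m \<le> n")
      case True
      then show ?thesis
        using mf by (simp add: i_def cong_iff_dvd_diff dvd_diff_commute)
    next
      case False
      have "int i - (- f) = int p + (f - int m)"
        using False m(2) by (simp add: i_def of_nat_diff)
      moreover have "int p dvd int p + (f - int m)"
        using mf by (rule dvd_add[OF dvd_refl])
      ultimately have "int p dvd int i - (- f)"
        by (simp only:)
      then have "[int i = - f] (mod int p)"
        by (simp only: cong_iff_dvd_diff)
      then show ?thesis ..
    qed
    then have "[(int i)\<^sup>2 = f\<^sup>2] (mod int p)"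
      using cong_pow[of "int i" f "int p" 2] cong_pow[of "int i" "- f" "int p" 2] by auto
    then have "[(int i)\<^sup>2 + 1 = f\<^sup>2 + 1] (mod int p)"
      by (rule cong_add) simp
    then show ?thesis
      using f by (simp add: cong_dvd_iff)
  qed
  have i: "i \<in> {1..n}"
  proof -
    have "i \<noteq> 0"
      using i2 p_gt_2 by (intro notI) simp
    moreover have "i \<le> n"
      using p_eq by (auto simp: i_def)
    ultimately show ?thesis by simp
  qed
  have nonzero: "odd (chi (int x * ((int x)\<^sup>2 + 1)))" if x: "x \<in> {1..n} - {i}" for x
  proof -
    have "\<not> int p dvd int x * ((int x)\<^sup>2 + 1)"
    proof
      assume "int p dvd int x * ((int x)\<^sup>2 + 1)"
      moreover have "\<not> int p dvd int x"
        using x p_eq dvd_abs_less_imp_eq_0[of "int p" "int x"] by auto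
      ultimately have "int p dvd (int x)\<^sup>2 + 1"
        using prime by (simp add: prime_dvd_mult_iff)
      then have "int p dvd ((int x)\<^sup>2 + 1) - ((int i)\<^sup>2 + 1)"
        using i2 by (rule dvd_diff)
      then have "int p dvd (int x - int i) * (int x + int i)"
        by (simp add: power2_eq_square algebra_simps)
      then have "int p dvd int x - int i \<or> int p dvd int x + int i"
        using prime by (simp add: prime_dvd_mult_iff)
      moreover have "\<bar>int x - int i\<bar> < int p" "\<bar>int x + int i\<bar> < int p"
        using x i p_eq by auto
      ultimately have "int x - int i = 0 \<or> int x + int i = 0"
        using dvd_abs_less_imp_eq_0 by blast
      then show False
        using x i by auto
    qed
    then have "chi (int x * ((int x)\<^sup>2 + 1)) \<noteq> 0"
      by (simp add: chi_0_iff)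
    then show ?thesis
      using Legendre_values[of "int x * ((int x)\<^sup>2 + 1)" "int p"] by auto
  qed
  have split: "(\<Sum>x\<in>{1..n}. chi (int x * ((int x)\<^sup>2 + 1)))
      = chi (int i * ((int i)\<^sup>2 + 1)) + (\<Sum>x\<in>{1..n} - {i}. chi (int x * ((int x)\<^sup>2 + 1)))"
    using i by (intro sum.remove) auto
  have "chi (int i * ((int i)\<^sup>2 + 1)) = 0"
    using i2 by (simp add: chi_0_iff)
  moreover have "{x \<in> {1..n} - {i}. odd (chi (int x * ((int x)\<^sup>2 + 1)))} = {1..n} - {i}"
    using nonzero by auto
  then have "odd (\<Sum>x\<in>{1..n} - {i}. chi (int x * ((int x)\<^sup>2 + 1)))"
    using i even_n n_pos by (subst even_sum_iff) (auto simp: card_Diff_singleton)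
  ultimately show ?thesis
    unfolding split by simp
qed

lemma two_squares_unique:
  fixes a b A B :: int
  assumes "int p = a\<^sup>2 + b\<^sup>2" "int p = A\<^sup>2 + B\<^sup>2" "odd a" "odd A"
  shows "A\<^sup>2 = a\<^sup>2"
proof -
  have main: "A\<^sup>2 = a\<^sup>2" if B: "int p = A\<^sup>2 + B\<^sup>2" and dvd: "int p dvd a * B - b * A" for B
  proof -
    have "(a * B - b * A)\<^sup>2 + (a * A + b * B)\<^sup>2 = (a\<^sup>2 + b\<^sup>2) * (A\<^sup>2 + B\<^sup>2)"
      by (simp add: power2_eq_square algebra_simps)
    then have sq: "(a * B - b * A)\<^sup>2 + (a * A + b * B)\<^sup>2 = (int p)\<^sup>2"
      using assms(1) B by (simp add: power2_eq_square)
    have "a * A + b * B \<noteq> 0"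
    proof -
      have "odd (int p)" using p_eq by simp
      then have "odd (a\<^sup>2 + b\<^sup>2)" "odd (A\<^sup>2 + B\<^sup>2)"
        using assms(1) B by metis+
      then have "even b" "even B"
        using assms(3,4) by simp_all
      then have "odd (a * A + b * B)"
        using assms(3,4) by simp
      then show ?thesis by (metis even_zero)
    qed
    then have "(a * A + b * B)\<^sup>2 > 0"
      by simp
    then have "\<bar>a * B - b * A\<bar>\<^sup>2 < (int p)\<^sup>2"
      unfolding power2_abs using sq by linarith
    then have "\<bar>a * B - b * A\<bar> < int p"
      by (rule power2_less_imp_less) simp
    then have "a * B - b * A = 0"
      using dvd by (intro dvd_abs_less_imp_eq_0)
    then have "a\<^sup>2 * B\<^sup>2 = b\<^sup>2 * A\<^sup>2"
      by (simp flip: power_mult_distrib)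
    moreover have "int p - A\<^sup>2 = B\<^sup>2" "int p - a\<^sup>2 = b\<^sup>2"
      using assms(1) B by simp_all
    ultimately have "a\<^sup>2 * (int p - A\<^sup>2) = (int p - a\<^sup>2) * A\<^sup>2"
      by (simp only:)
    then have "int p * (a\<^sup>2 - A\<^sup>2) = 0"
      by (simp add: algebra_simps)
    then show ?thesis
      using p_gt_2 by simp
  qed
  have "(a * B - b * A) * (a * B + b * A) = a\<^sup>2 * (A\<^sup>2 + B\<^sup>2) - (a\<^sup>2 + b\<^sup>2) * A\<^sup>2"
    by (simp add: power2_eq_square algebra_simps)
  also have "\<dots> = int p * (a\<^sup>2 - A\<^sup>2)"
    using assms(1,2) by (simp add: algebra_simps)
  finally have "int p dvd (a * B - b * A) * (a * B + b * A)"
    by simp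
  then have "int p dvd a * B - b * A \<or> int p dvd a * B + b * A"
    using prime by (simp add: prime_dvd_mult_iff)
  moreover have "int p dvd a * (- B) - b * A" if "int p dvd a * B + b * A"
  proof -
    have "a * (- B) - b * A = - (a * B + b * A)"
      by simp
    then show ?thesis
      using that by (simp only: dvd_minus_iff)
  qed
  ultimately show ?thesis
    using main[of B] main[of "- B"] assms(2) by auto
qed

text \<open>
  Half the Jacobsthal sums for \<open>1\<close> and for a nonresidue are the two squares that represent \<open>p\<close>,
  and the first of them is the odd one. Modulo \<open>p\<close> it is half the binomial coefficient, up to
  sign.
\<close>

theorem gauss_binomial_square:
  fixes a b :: int
  assumes "int p = a\<^sup>2 + b\<^sup>2" "odd a"
  shows "[(int (n choose (n div 2)))\<^sup>2 = 4 * a\<^sup>2] (mod int p)"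
proof -
  obtain g where g: "chi g = -1"
    using ex_nonresidue by blast
  define A where "A = (\<Sum>x\<in>{1..n}. chi (int x * ((int x)\<^sup>2 + 1)))"
  define B where "B = (\<Sum>x\<in>{1..n}. chi (int x * ((int x)\<^sup>2 + g)))"
  have A: "jacobsthal p 1 = 2 * A" and B: "jacobsthal p g = 2 * B"
    by (simp_all add: jacobsthal_half A_def B_def)
  have "int p = A\<^sup>2 + B\<^sup>2"
    using jacobsthal_two_squares[OF g] by (simp add: A B power_mult_distrib)
  moreover have "odd A"
    unfolding A_def by (rule jacobsthal_half_odd)
  ultimately have "A\<^sup>2 = a\<^sup>2"
    using two_squares_unique[OF assms(1)] assms(2) by blast
  have "[(- (int (n choose (n div 2)) * 1 ^ (n div 2)))\<^sup>2 = (jacobsthal p 1)\<^sup>2] (mod int p)"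
    by (intro cong_pow cong_sym[OF jacobsthal_cong])
  then show ?thesis
    by (simp add: A power_mult_distrib \<open>A\<^sup>2 = a\<^sup>2\<close>)
qed

end

section \<open>The Legendre symbol of a square root of 5\<close>

lemma thue:
  fixes r :: int
  assumes "prime p"
  shows "\<exists>x y :: int. (x \<noteq> 0 \<or> y \<noteq> 0)
      \<and> x\<^sup>2 < int p \<and> y\<^sup>2 < int p \<and> int p dvd x - r * y"
proof -
  have p: "p > 1" using assms by (rule prime_gt_1_nat)
  define k where "k = (GREATEST k. k\<^sup>2 \<le> p)"
  have bound: "m \<le> p" if "m\<^sup>2 \<le> p" for m :: nat
    using that by (cases "m = 0") (auto simp: power2_eq_square intro: order_trans[of m "m * m"])
  have k1: "k\<^sup>2 \<le> p"
    unfolding k_def by (rule GreatestI_nat[of _ 0 p]) (use bound in auto)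
  have k2: "p < (Suc k)\<^sup>2"
  proof (rule ccontr)
    assume "\<not> p < (Suc k)\<^sup>2"
    then have "Suc k \<le> k"
      unfolding k_def by (intro Greatest_le_nat[of _ _ p]) (use bound in auto)
    then show False by simp
  qed
  have "k\<^sup>2 \<noteq> p"
    using assms prime_power_iff[of k 2] by auto
  with k1 have k3: "k\<^sup>2 < p" by simp
  define f where "f = (\<lambda>(i, j). (int i - r * int j) mod int p)"
  have "f ` ({..k} \<times> {..k}) \<subseteq> {0..<int p}"
    using p by (auto simp: f_def)
  then have "card (f ` ({..k} \<times> {..k})) \<le> p"
    using card_mono[of "{0..<int p}"] by fastforce
  also have "p < card ({..k} \<times> {..k})"
    using k2 by (simp add: card_cartesian_product power2_eq_square)
  finally have "\<not> inj_on f ({..k} \<times> {..k})"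
    by (rule pigeonhole)
  then obtain i j i' j' where ij: "i \<le> k" "j \<le> k" "i' \<le> k" "j' \<le> k" "(i, j) \<noteq> (i', j')" "f (i, j) = f (i', j')"
    unfolding inj_on_def by auto
  define x y where "x = int i - int i'" and "y = int j - int j'"
  have "\<bar>x\<bar> \<le> int k" "\<bar>y\<bar> \<le> int k"
    using ij by (auto simp: x_def y_def)
  then have "x\<^sup>2 \<le> (int k)\<^sup>2" "y\<^sup>2 \<le> (int k)\<^sup>2"
    by (simp_all add: abs_le_square_iff[symmetric])
  moreover have "(int k)\<^sup>2 < int p"
    using k3 by (metis of_nat_less_iff of_nat_power)
  ultimately have "x\<^sup>2 < int p" "y\<^sup>2 < int p"
    by linarith+
  moreover have "x \<noteq> 0 \<or> y \<noteq> 0"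
    using ij(5) by (auto simp: x_def y_def)
  moreover have "x - r * y = (int i - r * int j) - (int i' - r * int j')"
    by (simp add: x_def y_def algebra_simps)
  moreover have "int p dvd (int i - r * int j) - (int i' - r * int j')"
    using ij(6) by (simp add: f_def mod_eq_dvd_iff)
  ultimately show ?thesis
    by metis
qed

lemma square_eq_5_square:
  fixes x y :: int
  assumes "x\<^sup>2 = 5 * y\<^sup>2"
  shows "y = 0"
proof (rule ccontr)
  assume y: "y \<noteq> 0"
  obtain x' y' where d: "x = x' * gcd x y" "y = y' * gcd x y" "coprime x' y'"
    using gcd_coprime_exists[of x y] y by auto
  have "gcd x y \<noteq> 0" using y by simp
  have "(gcd x y)\<^sup>2 * x'\<^sup>2 = (gcd x y)\<^sup>2 * (5 * y'\<^sup>2)"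
    using assms d(1,2) by (metis mult.left_commute mult.commute power_mult_distrib)
  then have e: "x'\<^sup>2 = 5 * y'\<^sup>2"
    using \<open>gcd x y \<noteq> 0\<close> by (metis mult_left_cancel power_not_zero)
  then have "y'\<^sup>2 dvd x'\<^sup>2" by simp
  moreover have "coprime (x'\<^sup>2) (y'\<^sup>2)"
    using d(3) by simp
  ultimately have "y'\<^sup>2 = 1"
    by (metis abs_power2 coprime_absorb_right zdvd1_eq)
  then have "x'\<^sup>2 = 5" using e by simp
  then have "\<bar>x'\<bar>\<^sup>2 < 3\<^sup>2" "\<bar>x'\<bar>\<^sup>2 > 2\<^sup>2"
    by simp_all
  then have "\<bar>x'\<bar> < 3" "\<bar>x'\<bar> > 2"
    by (auto dest: power_less_imp_less_base intro: power2_less_imp_less)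
  then show False by simp
qed

text \<open>
  By Thue's lemma some nonzero \<open>x^2 - 5 y^2\<close> is one of \<open>-p\<close>, \<open>-2p\<close>, \<open>-3p\<close> and \<open>-4p\<close>. Congruences
  exclude \<open>-2p\<close> and \<open>-3p\<close>. The values \<open>-p\<close> and \<open>-4p\<close> lead to \<open>p\<close> by multiplication with the units
  \<open>2 + sqrt 5\<close> and \<open>(1 + sqrt 5) / 2\<close>, both of norm \<open>-1\<close>, and by cancelling a factor \<open>2\<close>.
\<close>

lemma prime_norm_form_5:
  fixes r :: int
  assumes p: "prime p" "odd p" "p \<noteq> 3" and r: "[r\<^sup>2 = 5] (mod int p)"
  shows "\<exists>u v :: int. int p = u\<^sup>2 - 5 * v\<^sup>2"
proof -
  have p0: "int p > 0" using p(1) by (simp add: prime_gt_0_nat)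
  have odd_p: "odd (int p)" using p(2) by simp
  obtain x y where xy: "x \<noteq> 0 \<or> y \<noteq> 0" "x\<^sup>2 < int p" "y\<^sup>2 < int p" "int p dvd x - r * y"
    using thue[OF p(1)] by blast
  have "int p dvd (x - r * y) * (x + r * y) + (r\<^sup>2 - 5) * y\<^sup>2"
    using xy(4) r by (simp add: cong_iff_dvd_diff)
  also have "(x - r * y) * (x + r * y) + (r\<^sup>2 - 5) * y\<^sup>2 = x\<^sup>2 - 5 * y\<^sup>2"
    by (simp add: power2_eq_square algebra_simps)
  finally obtain m where m: "x\<^sup>2 - 5 * y\<^sup>2 = int p * m" ..
  have "int p * m < int p * 1" "int p * (-5) < int p * m"
    using xy(2,3) m zero_le_power2[of x] zero_le_power2[of y] by linarith+
  then have "m < 1" "-5 < m"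
    using p0 by (simp_all only: mult_less_cancel_left_pos)
  have case_1: ?thesis if "x\<^sup>2 - 5 * y\<^sup>2 = - int p" for x y
  proof -
    have "int p = (2 * x + 5 * y)\<^sup>2 - 5 * (x + 2 * y)\<^sup>2"
      using that by (simp add: power2_eq_square algebra_simps)
    then show ?thesis by blast
  qed
  have case_4: ?thesis if "x\<^sup>2 - 5 * y\<^sup>2 = -4 * int p" "4 dvd x + y" for x y
  proof -
    from that(2) obtain w where "x + y = 4 * w" ..
    then have x: "x = 4 * w - y" by simp
    have "int p = (w + y)\<^sup>2 - 5 * w\<^sup>2"
      using that(1) unfolding x by (simp add: power2_eq_square algebra_simps)
    then show ?thesis by blast
  qed
  show ?thesis
  proof -
    consider "m = 0" | "m = -1" | "m = -2" | "m = -3" | "m = -4"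
      using \<open>m < 1\<close> \<open>-5 < m\<close> by linarith
    then show ?thesis
    proof cases
      case 1
      then have "y = 0"
        using m by (intro square_eq_5_square[of x y]) simp
      then show ?thesis
        using xy(1) m 1 by simp
    next
      case 2
      then show ?thesis using m by (intro case_1) simp
    next
      case 3
      then have e: "x\<^sup>2 - 5 * y\<^sup>2 = - 2 * int p" using m by simp
      then have "even (x\<^sup>2 - 5 * y\<^sup>2)" by simp
      then have "even (x - y)" by simp
      then obtain w where "x - y = 2 * w" ..
      then have x: "x = y + 2 * w" by simp
      have "int p = 2 * (y\<^sup>2 - w * y - w\<^sup>2)"
        using e unfolding x by (simp add: power2_eq_square algebra_simps)
      then show ?thesis using odd_p by simp
    next
      case 4
      then have e: "x\<^sup>2 - 5 * y\<^sup>2 = - 3 * int p" using m by simp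
      have sq: "z\<^sup>2 mod 3 = (if 3 dvd z then 0 else 1)" for z :: int
      proof -
        consider "z mod 3 = 0" | "z mod 3 = 1" | "z mod 3 = 2" by linarith
        then show ?thesis
          by cases (auto simp: power_mod[of z 3 2, symmetric] dvd_eq_mod_eq_0)
      qed
      have "x\<^sup>2 + y\<^sup>2 = 3 * (2 * y\<^sup>2 - int p)"
        using e by simp
      then have "(x\<^sup>2 mod 3 + y\<^sup>2 mod 3) mod 3 = 0"
        by (simp add: mod_add_eq)
      then have "3 dvd x" "3 dvd y"
        unfolding sq by (auto split: if_splits)
      then obtain x' y' where "x = 3 * x'" "y = 3 * y'"
        by (auto elim!: dvdE)
      then have "int p = 3 * (5 * y'\<^sup>2 - x'\<^sup>2)"
        using e by (simp add: power2_eq_square)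
      then have "int 3 dvd int p" by simp
      then have "3 dvd p" by (simp only: of_nat_dvd_iff)
      then have "p = 3"
        using p(1) by (auto dest: primes_dvd_imp_eq[rotated 2])
      then show ?thesis using p(3) by simp
    next
      case 5
      then have e: "x\<^sup>2 - 5 * y\<^sup>2 = - 4 * int p" using m by simp
      then have "even (x\<^sup>2 - 5 * y\<^sup>2)" by simp
      then have par: "even x = even y" by simp
      show ?thesis
      proof (cases "even x")
        case True
        with par obtain x' y' where "x = 2 * x'" "y = 2 * y'"
          by (auto elim!: evenE)
        then show ?thesis
          using e by (intro case_1[of x' y']) (simp add: power2_eq_square)
      next
        case False
        then have "4 dvd x + y \<or> 4 dvd x + (- y)"
          using par by presburger
        then show ?thesis
          using case_4[of x y] case_4[of x "- y"] e by auto
      qed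
    qed
  qed
qed

text \<open>
  The quadratic character modulo \<open>20\<close> of the field generated by the square root of \<open>-5\<close>. The value
  \<open>-1\<close> at integers not coprime to \<open>20\<close> is arbitrary.
\<close>

definition psi :: "int \<Rightarrow> int" where
  "psi a = (if a mod 20 \<in> {1, 3, 7, 9} then 1 else -1)"

lemma unit_mod_20:
  fixes a :: int
  assumes "odd a" "\<not> 5 dvd a"
  shows "a mod 20 \<in> {1, 3, 7, 9, 11, 13, 17, 19}"
  using assms by (simp, presburger)

lemma psi_mult:
  assumes "odd a" "\<not> 5 dvd a" "odd b" "\<not> 5 dvd b"
  shows "psi (a * b) = psi a * psi b"
  using unit_mod_20[OF assms(1,2)] unit_mod_20[OF assms(3,4)]
  unfolding psi_def mod_mult_eq[of a 20 b, symmetric]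
  by (elim insertE; simp)

text \<open>
  The finite computation modulo \<open>20\<close> that concludes the evaluation of the Legendre symbol of \<open>r\<close>.
\<close>

lemma psi_shift:
  assumes "odd u" "\<not> 5 dvd u" "even b" "5 dvd b \<or> 5 dvd u - b" "psi (u + b) = 1"
  shows "psi u * (if 4 dvd b then 1 else -1) = (if 5 dvd b then 1 else -1)"
proof -
  define x y where "x = u mod 20" and "y = b mod 20"
  have y: "y \<in> {0, 10} \<and> 5 dvd b \<or> y \<in> {2, 4, 6, 8, 12, 14, 16, 18} \<and> \<not> 5 dvd b"
    using assms(3) unfolding y_def by (simp, presburger)
  have four: "4 dvd b \<longleftrightarrow> 4 dvd y"
    unfolding y_def by presburger
  have five: "5 dvd b \<or> x mod 5 = y mod 5"
    using assms(4) by (simp add: x_def y_def mod_mod_cancel mod_eq_dvd_iff)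
  have sum: "psi (u + b) = psi (x + y)" and u: "psi u = psi x"
    by (simp_all add: psi_def x_def y_def mod_add_eq)
  have "x \<in> {1, 3, 7, 9, 11, 13, 17, 19}"
    using unit_mod_20[OF assms(1,2)] by (simp only: x_def)
  then show ?thesis
    using y five assms(5) unfolding sum u four
    by (elim insertE emptyE disjE conjE) (simp_all add: psi_def)
qed

lemma Legendre_5:
  "Legendre a 5 = (if a mod 5 = 0 then 0 else if a mod 5 \<in> {1, 4} then 1 else -1)"
proof -
  have eu: "[Legendre a (int 5) = a ^ 2] (mod int 5)"
    using euler_criterion[of 5 a] by simp
  have "[a = a mod 5] (mod 5)" by simp
  then have "[a\<^sup>2 = (a mod 5)\<^sup>2] (mod 5)" by (rule cong_pow)
  with eu have c: "[Legendre a 5 = (a mod 5)\<^sup>2] (mod 5)"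
    by (auto intro: cong_trans)
  consider "a mod 5 = 0" | "a mod 5 = 1" | "a mod 5 = 2" | "a mod 5 = 3" | "a mod 5 = 4"
    by linarith
  then show ?thesis
    using c Legendre_values[of a 5] by cases (auto simp: cong_def)
qed

lemma Legendre_minus_5:
  assumes "prime l" "l \<noteq> 2" "l \<noteq> 5"
  shows "Legendre (-5) (int l) = psi (int l)"
proof -
  have l: "2 < l" "odd l"
    using assms prime_gt_1_nat[OF assms(1)] prime_odd_nat by (auto simp: order_less_le)
  have nd: "\<not> 5 dvd l"
    using assms(1,3) by (auto dest: primes_dvd_imp_eq[rotated 2])
  have "Legendre (int l) (int 5) * Legendre (int 5) (int l) = 1"
    using Quadratic_Reciprocity[of l 5] assms l by (simp add: power_mult)
  then have five: "Legendre 5 (int l) = Legendre (int l) 5"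
    using Legendre_values[of 5 "int l"] Legendre_values[of "int l" 5] by auto
  have "Legendre (-5) (int l) = Legendre (-1) (int l) * Legendre 5 (int l)"
    using Legendre_mult[OF assms(1) l(1), of "-1" 5] by simp
  also have "\<dots> = (-1) ^ ((l - 1) div 2) * Legendre (int l) 5"
    unfolding five Legendre_minus_one[OF assms(1) l(1)] ..
  also have "\<dots> = psi (int l)"
  proof -
    define x where "x = int l mod 20"
    have "x \<in> {1, 3, 7, 9, 11, 13, 17, 19}"
      using nd l(2) unfolding x_def by (intro unit_mod_20) (auto simp: int_dvd_int_iff[of 5, simplified])
    then have "(if x mod 4 = 1 then 1 else -1)
        * (if x mod 5 = 0 then 0 else if x mod 5 \<in> {1, 4} then 1 else -1)
        = (if x \<in> {1, 3, 7, 9} then 1 else -1 :: int)"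
      by (elim insertE emptyE) simp_all
    moreover have "x mod 5 = int l mod 5" "x mod 4 = int l mod 4"
      by (simp_all add: x_def mod_mod_cancel)
    moreover have "even ((l - 1) div 2) \<longleftrightarrow> int l mod 4 = 1"
      using l(2) by presburger
    then have "(-1) ^ ((l - 1) div 2) = (if int l mod 4 = 1 then 1 else -1 :: int)"
      by (cases "even ((l - 1) div 2)") simp_all
    ultimately show ?thesis
      unfolding Legendre_5 psi_def x_def[symmetric] by (simp only:)
  qed
  finally show ?thesis .
qed

text \<open>
  If a prime divisor of \<open>s\<close> divides \<open>v\<close>, then it divides \<open>a\<close> too and its square can be cancelled
  from \<open>s\<close>, because it does not divide \<open>t\<close>. Otherwise \<open>-5\<close> is a quadratic residue modulo this
  prime, so that \<open>psi\<close> has the value \<open>1\<close> at it.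
\<close>

lemma psi_divisor_norm_form:
  fixes a v t :: int and s :: nat
  assumes "odd s" "\<not> 5 dvd s" "int s * t = a\<^sup>2 + 5 * v\<^sup>2"
    and "\<And>l. prime l \<Longrightarrow> int l dvd int s \<Longrightarrow> int l dvd t
      \<Longrightarrow> int l dvd a \<Longrightarrow> int l dvd v \<Longrightarrow> False"
  shows "psi (int s) = 1"
  using assms
proof (induction s arbitrary: t a v rule: less_induct)
  case (less s)
  show ?case
  proof (cases "s = 1")
    case True
    then show ?thesis by (simp add: psi_def)
  next
    case False
    then obtain l where l: "prime l" "l dvd s"
      using prime_factor_nat by blast
    from l(2) obtain s' where s': "s = l * s'" ..
    have l25: "l \<noteq> 2" "l \<noteq> 5" "2 < l"
      using l less.prems(1,2) prime_gt_1_nat[OF l(1)] by (auto simp: order_less_le)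
    have odd: "odd (int l)" "\<not> 5 dvd int l" "odd (int s')" "\<not> 5 dvd int s'"
      using less.prems(1,2) unfolding s' by (auto simp: int_dvd_int_iff[of 5, simplified])
    have "s' > 0" using less.prems(1) s' by (cases s') auto
    have dvd: "int l dvd a\<^sup>2 + 5 * v\<^sup>2"
      unfolding less.prems(3)[symmetric] s' by simp
    have pl: "prime (int l)" using l(1) by simp
    have l5: "\<not> int l dvd 5"
    proof
      assume "int l dvd 5"
      then have "int l dvd int 5" by simp
      then have "l dvd 5" by (simp only: of_nat_dvd_iff)
      then show False using l(1) l25(2) by (auto dest: primes_dvd_imp_eq[rotated 2])
    qed
    show ?thesis
    proof (cases "int l dvd v")
      case False
      have "\<not> int l dvd a"
      proof
        assume "int l dvd a"
        then have "int l dvd (a\<^sup>2 + 5 * v\<^sup>2) - a\<^sup>2"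
          using dvd by (intro dvd_diff) (auto simp: power2_eq_square)
        then show False
          using False l5 pl by (simp add: prime_dvd_mult_iff prime_dvd_power_iff)
      qed
      have "[a\<^sup>2 = -5 * v\<^sup>2] (mod int l)"
        using dvd by (simp add: cong_iff_dvd_diff)
      then have "Legendre (a\<^sup>2) (int l) = Legendre (-5) (int l) * Legendre (v\<^sup>2) (int l)"
        using Legendre_cong Legendre_mult[OF l(1) l25(3)] by metis
      then have "psi (int l) = 1"
        using Legendre_square[OF l(1) l25(3)] False \<open>\<not> int l dvd a\<close> Legendre_minus_5[OF l(1) l25(1,2)] by simp
      moreover have "psi (int s') = 1"
      proof (rule less.IH)
        show "s' < s" using s' l25(3) \<open>s' > 0\<close> by simp
        show "odd s'" "\<not> 5 dvd s'" using less.prems(1,2) s' by auto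
        show "int s' * (int l * t) = a\<^sup>2 + 5 * v\<^sup>2"
          using less.prems(3) s' by (simp add: mult_ac)
        fix q assume q: "prime q" "int q dvd int s'" "int q dvd int l * t" "int q dvd a" "int q dvd v"
        have "q \<noteq> l" using q(5) False by auto
        then have "\<not> int q dvd int l"
          using q(1) l(1) by (auto dest: primes_dvd_imp_eq)
        then have "int q dvd t"
          using q(1,3) by (simp add: prime_dvd_mult_iff)
        then show False
          using less.prems(4)[of q] q s' by simp
      qed
      ultimately show ?thesis
        using psi_mult[OF odd] s' by simp
    next
      case True
      then have "int l dvd a\<^sup>2"
        using dvd by (metis dvd_add_left_iff dvd_mult power2_eq_square)
      then have "int l dvd a"
        using pl by (simp add: prime_dvd_power_iff)
      with True obtain a' v' where av: "a = int l * a'" "v = int l * v'"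
        by (auto elim!: dvdE)
      have "\<not> int l dvd t"
        using less.prems(4)[OF l(1)] \<open>int l dvd a\<close> True l(2) by auto
      have e: "int s' * t = int l * (a'\<^sup>2 + 5 * v'\<^sup>2)"
      proof -
        have "int l * (int s' * t) = int l * (int l * (a'\<^sup>2 + 5 * v'\<^sup>2))"
          using less.prems(3) unfolding av s' by (simp add: power2_eq_square algebra_simps)
        then show ?thesis using pl by simp
      qed
      then have "int l dvd int s' * t" by simp
      then have "l dvd s'"
        using pl \<open>\<not> int l dvd t\<close> by (simp add: prime_dvd_mult_iff)
      then obtain s1 where s1: "s' = l * s1" ..
      have odd1: "odd (int s1)" "\<not> 5 dvd int s1"
        using odd(3,4) unfolding s1 by auto
      have "s1 > 0" using \<open>s' > 0\<close> s1 by (cases s1) auto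
      have "psi (int s1) = 1"
      proof (rule less.IH)
        have "s1 \<le> s'" using s1 l25(3) by simp
        also have "s' < s" using s' l25(3) \<open>s' > 0\<close> by simp
        finally show "s1 < s" .
        show "odd s1" "\<not> 5 dvd s1" using less.prems(1,2) s' s1 by auto
        show "int s1 * t = a'\<^sup>2 + 5 * v'\<^sup>2"
          using e pl unfolding s1 by simp
        fix q assume "prime q" "int q dvd int s1" "int q dvd t" "int q dvd a'" "int q dvd v'"
        then show False
          using less.prems(4)[of q] s' s1 av by simp
      qed
      moreover have "psi (int l) * psi (int l) = 1"
        by (simp add: psi_def)
      ultimately show ?thesis
        using psi_mult[OF odd] psi_mult[OF odd(1,2) odd1] s' s1 by simp
    qed
  qed
qed

lemma multiplicative_eqI:
  fixes f g :: "nat \<Rightarrow> int"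
  assumes "N > 0" "f 1 = g 1"
    and "\<And>l. prime l \<Longrightarrow> l dvd N \<Longrightarrow> f l = g l"
    and "\<And>a b. a * b dvd N \<Longrightarrow> f (a * b) = f a * f b"
    and "\<And>a b. a * b dvd N \<Longrightarrow> g (a * b) = g a * g b"
  shows "f N = g N"
  using assms(1,3-5)
proof (induction N rule: less_induct)
  case (less N)
  show ?case
  proof (cases "N = 1")
    case True
    then show ?thesis using assms(2) by simp
  next
    case False
    then obtain l where l: "prime l" "l dvd N"
      using prime_factor_nat by blast
    from l(2) obtain m where m: "N = l * m" ..
    have "f m = g m"
    proof (rule less.IH)
      show "m < N" "m > 0"
        using m less.prems(1) prime_gt_1_nat[OF l(1)] by auto
    qed (use less.prems m in \<open>auto intro: dvd_mult\<close>)
    then show ?thesis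
      using less.prems(3)[of l m] less.prems(4)[of l m] less.prems(2)[OF l] m by simp
  qed
qed

context prime_1_mod_4
begin

text \<open>
  If \<open>f^2 = -1\<close>, then \<open>2 f = (1 + f)^2\<close>, so \<open>2\<close> and \<open>f\<close> have the same character.
\<close>

lemma chi_2: "chi 2 = (if p mod 8 = 1 then 1 else -1)"
proof -
  have "chi (-1) = 1"
    using Legendre_minus_one[OF prime p_gt_2] even_n by (simp add: n_eq)
  then have "QuadRes (int p) (-1)"
    by (simp add: Legendre_def split: if_splits)
  then obtain f where f: "[f\<^sup>2 = -1] (mod int p)"
    by (auto simp: QuadRes_def)
  have "\<not> int p dvd 1 + f"
  proof
    assume "int p dvd 1 + f"
    then have "[f = -1] (mod int p)"
      by (simp add: cong_iff_dvd_diff add.commute)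
    then have "[f\<^sup>2 = 1] (mod int p)"
      using cong_pow[of f "-1" "int p" 2] by simp
    with f have "[1 = -1] (mod int p)"
      by (metis cong_sym cong_trans)
    then have "int p dvd 2" by (simp add: cong_iff_dvd_diff)
    then show False using p_gt_2 zdvd_imp_le by fastforce
  qed
  then have "chi ((1 + f)\<^sup>2) = 1" by (rule chi_square)
  moreover have "[(1 + f)\<^sup>2 = 2 * f] (mod int p)"
    using f by (simp add: cong_iff_dvd_diff power2_eq_square algebra_simps)
  ultimately have "chi 2 * chi f = 1"
    using Legendre_cong chi_mult by metis
  then have eq: "chi 2 = chi f"
    using Legendre_values[of 2 "int p"] Legendre_values[of f "int p"] by auto
  obtain h where h: "n = 2 * h" using even_n by (elim evenE)
  have "[chi f = (f\<^sup>2) ^ h] (mod int p)"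
    using chi_power[of f] by (simp add: h power_mult)
  also have "[(f\<^sup>2) ^ h = (-1) ^ h] (mod int p)"
    by (intro cong_pow f)
  finally have "chi f = (-1) ^ h"
    by (rule Legendre_eqI[OF p_gt_2]) (cases "even h"; simp)
  moreover have "even h \<longleftrightarrow> p mod 8 = 1"
    unfolding p_eq h by presburger
  ultimately show ?thesis
    using eq by simp
qed

lemma chi_prime:
  assumes "prime l" "l \<noteq> 2" "l \<noteq> p"
  shows "chi (int l) = Legendre (int p) (int l)"
proof -
  have l: "2 < l"
    using assms prime_gt_1_nat[OF assms(1)] by (auto simp: order_less_le)
  have "Legendre (int l) (int p) * Legendre (int p) (int l) = (-1) ^ ((l - 1) div 2 * n)"
    using Quadratic_Reciprocity[OF assms(1) l prime p_gt_2] assms(3) by (simp add: n_eq)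
  also have "\<dots> = 1" using even_n by simp
  finally show ?thesis
    using Legendre_values[of "int l" "int p"] Legendre_values[of "int p" "int l"] by auto
qed

text \<open>
  Take \<open>p = u^2 - 5 v^2\<close>, so that \<open>r\<close> is \<open>u / v\<close> up to sign. By quadratic reciprocity the symbol
  of \<open>u\<close> is \<open>psi u\<close>, and the symbol of \<open>v\<close> depends only on \<open>p\<close> modulo \<open>8\<close>. The relation with
  \<open>p = a^2 + b^2\<close> is the factorization \<open>(u + b) (u - b) = a^2 + 5 v^2\<close>: it shows that
  \<open>psi (u + b) = 1\<close>, provided that the sign of \<open>b\<close> is such that \<open>5\<close> does not divide \<open>u + b\<close>.
\<close>

theorem chi_sqrt_5:
  fixes a b r :: int
  assumes r: "[r\<^sup>2 = 5] (mod int p)" and "p \<noteq> 5"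
    and ab: "int p = a\<^sup>2 + b\<^sup>2" "odd a" and five: "5 dvd a \<or> 5 dvd b"
  shows "chi r = (if 5 dvd b then 1 else -1)"
proof -
  have odd_p: "odd p" using p_eq by simp
  have "p \<noteq> 3" using p_eq even_n by presburger
  then obtain u0 v0 where uv0: "int p = u0\<^sup>2 - 5 * v0\<^sup>2"
    using prime_norm_form_5[OF prime odd_p _ r] by blast
  define u v where "u = nat \<bar>u0\<bar>" and "v = nat \<bar>v0\<bar>"
  have uv: "int p = (int u)\<^sup>2 - 5 * (int v)\<^sup>2"
    using uv0 by (simp add: u_def v_def)
  have even_b: "even b"
  proof -
    have "odd (a\<^sup>2 + b\<^sup>2)" using odd_p ab(1) by (metis even_of_nat)
    then show ?thesis using ab(2) by simp
  qed
  have p4: "int p mod 4 = 1"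
    using p_eq even_n by presburger
  have par: "odd u" "even v"
  proof -
    have sq4: "z\<^sup>2 mod 4 = (if even z then 0 else 1)" for z :: int
    proof (cases "even z")
      case True
      then obtain w where "z = 2 * w" ..
      then have "z\<^sup>2 = 4 * w\<^sup>2" by (simp add: power2_eq_square)
      then show ?thesis using True by simp
    next
      case False
      then obtain w where "z = 2 * w + 1" by (elim oddE)
      then have "z\<^sup>2 = 1 + 4 * (w\<^sup>2 + w)" by (simp add: power2_eq_square algebra_simps)
      then have "z\<^sup>2 mod 4 = 1" by (simp only: mod_mult_self2) simp
      then show ?thesis using False by simp
    qed
    have "(int u)\<^sup>2 mod 4 = (int p + 5 * (int v)\<^sup>2) mod 4"
      using uv by simp
    also have "\<dots> = (1 + 5 * ((int v)\<^sup>2 mod 4)) mod 4"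
      using p4 by (metis mod_add_eq mod_mult_right_eq mod_mod_trivial)
    finally show "odd u" "even v"
      unfolding sq4 by (auto split: if_splits)
  qed
  have coprime_uv: "False" if "prime l" "int l dvd int u" "int l dvd int v" for l
  proof -
    have "(int l)\<^sup>2 dvd (int u)\<^sup>2 - 5 * (int v)\<^sup>2"
      using that by (intro dvd_diff dvd_mult dvd_power_same)
    then have "int (l\<^sup>2) dvd int p" using uv by simp
    then have "l\<^sup>2 dvd p" by (simp only: of_nat_dvd_iff)
    then have "l dvd p" "l * l dvd p"
      by (auto simp: power2_eq_square intro: dvd_mult_left)
    then have "l = p" using that(1) prime by (auto dest: primes_dvd_imp_eq)
    then show False using \<open>l * l dvd p\<close> that(1) prime_gt_1_nat[OF prime] by simp
  qed
  have nd5: "\<not> 5 dvd u"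
  proof
    assume "5 dvd u"
    then have "5 dvd (int u)\<^sup>2 - 5 * (int v)\<^sup>2"
      by (auto simp: power2_eq_square intro!: dvd_diff)
    then have "int 5 dvd int p" using uv by simp
    then have "5 dvd p" by (simp only: of_nat_dvd_iff)
    then show False using prime \<open>p \<noteq> 5\<close> by (auto dest: primes_dvd_imp_eq[rotated 2])
  qed
  have p_nd: "\<not> p dvd u" "\<not> p dvd v"
  proof -
    have pp: "prime (int p)" using prime by simp
    have "\<not> int p dvd 5"
    proof
      assume "int p dvd 5"
      then have "int p dvd int 5" by simp
      then have "p dvd 5" by (simp only: of_nat_dvd_iff)
      then show False using prime \<open>p \<noteq> 5\<close> by (auto dest: primes_dvd_imp_eq[rotated 2])
    qed
    moreover have "(int u)\<^sup>2 = int p + 5 * (int v)\<^sup>2" using uv by simp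
    then have "int p dvd (int u)\<^sup>2 \<longleftrightarrow> int p dvd 5 * (int v)\<^sup>2"
      by (simp add: dvd_add_right_iff)
    ultimately have "p dvd u \<longleftrightarrow> p dvd v"
      using pp by (simp add: prime_dvd_mult_iff prime_dvd_power_iff)
    then show "\<not> p dvd u" "\<not> p dvd v"
      using coprime_uv[OF prime] by auto
  qed
  have u0: "u > 0" and v0: "v > 0"
    using p_nd by (auto intro: gr0I)
  have chi_one: "chi 1 = 1"
    using chi_square[of 1] p_gt_2 by simp

  have chi_u: "chi (int u) = psi (int u)"
  proof (rule multiplicative_eqI[of u "\<lambda>d. chi (int d)" "\<lambda>d. psi (int d)", OF u0])
    show "chi (int 1) = psi (int 1)" using chi_one by (simp add: psi_def)
    show "chi (int (c * d)) = chi (int c) * chi (int d)" for c d by (simp add: chi_mult)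
    show "psi (int (c * d)) = psi (int c) * psi (int d)" if "c * d dvd u" for c d
    proof -
      have "odd (c * d)" "\<not> 5 dvd c * d"
        using that par(1) nd5 by (meson dvd_trans)+
      then show ?thesis
        unfolding of_nat_mult by (intro psi_mult) (auto simp: int_dvd_int_iff[of 5, simplified])
    qed
    fix l assume l: "prime l" "l dvd u"
    have ne: "l \<noteq> 2" "l \<noteq> 5" "l \<noteq> p"
      using l par(1) nd5 p_nd by auto
    then have l2: "2 < l" using prime_gt_1_nat[OF l(1)] by (auto simp: order_less_le)
    have "int l dvd int u" using l(2) by simp
    then have "\<not> int l dvd int v" using coprime_uv[OF l(1)] by blast
    have "int l dvd (int u)\<^sup>2" using \<open>int l dvd int u\<close> by (simp add: power2_eq_square)
    then have "[int p = -5 * (int v)\<^sup>2] (mod int l)"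
      unfolding uv cong_iff_dvd_diff by simp
    then have "Legendre (int p) (int l) = Legendre (-5) (int l) * Legendre ((int v)\<^sup>2) (int l)"
      using Legendre_cong Legendre_mult[OF l(1) l2] by metis
    then show "chi (int l) = psi (int l)"
      using chi_prime[OF l(1) ne(1,3)] Legendre_square[OF l(1) l2 \<open>\<not> int l dvd int v\<close>]
        Legendre_minus_5[OF l(1) ne(1,2)] by simp
  qed

  have chi_l: "chi (int l) = 1" if l: "prime l" "l dvd v" "l \<noteq> 2" for l
  proof -
    have "l \<noteq> p" using l p_nd by auto
    have l2: "2 < l" using l(3) prime_gt_1_nat[OF l(1)] by (auto simp: order_less_le)
    have "int l dvd int v" using l(2) by simp
    then have "\<not> int l dvd int u" using coprime_uv[OF l(1)] by blast
    have "int l dvd (int v)\<^sup>2" using \<open>int l dvd int v\<close> by (simp add: power2_eq_square)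
    then have "[int p = (int u)\<^sup>2] (mod int l)"
      unfolding uv cong_iff_dvd_diff by simp
    then show ?thesis
      using chi_prime[OF l(1,3) \<open>l \<noteq> p\<close>] Legendre_square[OF l(1) l2 \<open>\<not> int l dvd int u\<close>] Legendre_cong
      by metis
  qed
  have chi_v: "chi (int v) = (if p mod 8 = 1 then 1 else -1)"
  proof (cases "p mod 8 = 1")
    case True
    have "chi (int v) = 1"
    proof (rule multiplicative_eqI[of v "\<lambda>d. chi (int d)" "\<lambda>d. 1", OF v0])
      show "chi (int l) = 1" if "prime l" "l dvd v" for l
        using chi_l[OF that] chi_2 True by (cases "l = 2") auto
    qed (simp_all add: chi_mult chi_one)
    then show ?thesis using True by simp
  next
    case False
    from par(2) obtain w where w: "v = 2 * w" ..
    have "odd w"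
    proof
      assume "even w"
      then obtain w' where "w = 2 * w'" ..
      moreover obtain u' where "u = 2 * u' + 1" using par(1) by (elim oddE)
      moreover have "even (u' * (u' + 1))" by simp
      then obtain c where "u' * (u' + 1) = 2 * c" ..
      then have "int u' * (int u' + 1) = 2 * int c"
        by (metis of_nat_mult of_nat_add of_nat_1 of_nat_numeral)
      ultimately have "int p = 8 * int c + 1 - 80 * (int w')\<^sup>2"
        using uv w by (simp add: power2_eq_square algebra_simps)
      then have "int p = 1 + 8 * (int c - 10 * (int w')\<^sup>2)" by simp
      then have "int p mod 8 = 1" by (simp only: mod_mult_self2) simp
      then show False using False by presburger
    qed
    have "w > 0" using v0 w by simp
    have "chi (int w) = 1"
    proof (rule multiplicative_eqI[of w "\<lambda>d. chi (int d)" "\<lambda>d. 1", OF \<open>w > 0\<close>])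
      show "chi (int l) = 1" if "prime l" "l dvd w" for l
        using chi_l[of l] that w \<open>odd w\<close> by (cases "l = 2") auto
    qed (simp_all add: chi_mult chi_one)
    then show ?thesis
      using False w chi_mult[of 2 "int w"] chi_2 by simp
  qed

  have chi_r: "chi r = psi (int u) * (if p mod 8 = 1 then 1 else -1)"
  proof -
    have "int p dvd (r * int v)\<^sup>2 - (int u)\<^sup>2"
    proof -
      have "int p dvd (r\<^sup>2 - 5) * (int v)\<^sup>2 - int p"
        using r by (simp add: cong_iff_dvd_diff)
      also have "(r\<^sup>2 - 5) * (int v)\<^sup>2 - int p = (r * int v)\<^sup>2 - (int u)\<^sup>2"
        using uv by (simp add: power_mult_distrib algebra_simps)
      finally show ?thesis .
    qed
    also have "(r * int v)\<^sup>2 - (int u)\<^sup>2 = (r * int v - int u) * (r * int v - (- int u))"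
      by (simp add: power2_eq_square algebra_simps)
    finally have "[r * int v = int u] (mod int p) \<or> [r * int v = - int u] (mod int p)"
      unfolding cong_iff_dvd_diff using prime by (intro prime_dvd_multD) simp_all
    then have "chi (r * int v) = chi (int u)"
      by (auto dest: Legendre_cong simp: chi_minus)
    then have "chi r * chi (int v) = psi (int u)"
      by (simp add: chi_mult chi_u)
    then show ?thesis
      unfolding chi_v by (auto split: if_splits)
  qed

  \<comment> \<open>If \<open>5\<close> does not divide \<open>b\<close>, then \<open>5\<close> divides \<open>(u - b) (u + b)\<close>; choose the sign for which \<open>u\<close> and \<open>b\<close> are
      congruent modulo \<open>5\<close>, so that \<open>u + b\<close> is congruent to \<open>2 u\<close>.\<close>
  obtain b' where b': "b' = b \<or> b' = - b" and b'5: "\<not> 5 dvd b \<Longrightarrow> 5 dvd int u - b'"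
  proof (cases "5 dvd b")
    case False
    then have "5 dvd a" using five by simp
    then have "5 dvd a * a + 5 * (int v)\<^sup>2" by simp
    also have "a * a + 5 * (int v)\<^sup>2 = (int u - b) * (int u - (- b))"
      using uv ab(1) by (simp add: power2_eq_square algebra_simps)
    finally have "5 dvd int u - b \<or> 5 dvd int u - (- b)"
      by (subst (asm) prime_dvd_mult_iff) simp_all
    then show ?thesis using that by blast
  qed (use that in blast)
  define s where "s = nat (int u + b')"
  have "b'\<^sup>2 < (int u)\<^sup>2"
  proof -
    have "(int u)\<^sup>2 = a\<^sup>2 + b\<^sup>2 + 5 * (int v)\<^sup>2" using uv ab(1) by simp
    moreover have "a\<^sup>2 > 0" using ab(2) by auto
    moreover have "b'\<^sup>2 = b\<^sup>2" using b' by auto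
    ultimately show ?thesis using zero_le_power2[of "int v"] by linarith
  qed
  then have "\<bar>b'\<bar> < int u"
    by (intro power2_less_imp_less[of "\<bar>b'\<bar>"]) simp_all
  then have s: "int s = int u + b'" by (simp add: s_def)
  have st: "int s * (int u - b') = a\<^sup>2 + 5 * (int v)\<^sup>2"
    using uv ab(1) b' unfolding s by (auto simp: power2_eq_square algebra_simps)
  have s_units: "odd (int s)" "\<not> 5 dvd int s"
  proof -
    show "odd (int s)" using s par(1) even_b b' by auto
    have u5: "\<not> 5 dvd int u" using nd5 by (simp add: int_dvd_int_iff[of 5, simplified])
    show "\<not> 5 dvd int s"
    proof (cases "5 dvd b")
      case True
      then have "5 dvd b'" using b' by auto
      then show ?thesis using u5 unfolding s by (simp add: dvd_add_left_iff)
    next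
      case False
      then have "5 dvd int u - b'" by (rule b'5)
      then show ?thesis using u5 unfolding s by presburger
    qed
  qed
  have psi_s: "psi (int u + b') = 1"
    unfolding s[symmetric]
  proof (rule psi_divisor_norm_form[OF _ _ st])
    show "odd s" "\<not> 5 dvd s"
      using s_units by (simp_all add: int_dvd_int_iff[of 5, simplified])
    fix l assume l: "prime l" "int l dvd int s" "int l dvd int u - b'" "int l dvd a" "int l dvd int v"
    have "int l dvd int s + (int u - b')" using l by (intro dvd_add)
    then have "int l dvd 2 * int u" by (simp add: s)
    moreover have "l \<noteq> 2" using l(4) ab(2) by auto
    then have "\<not> int l dvd int 2"
      unfolding of_nat_dvd_iff using l(1) by (auto dest: primes_dvd_imp_eq[rotated 2])
    ultimately have "int l dvd int u"
      using l(1) by (simp add: prime_dvd_mult_iff)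
    then show False using coprime_uv l(1,5) by blast
  qed

  have mod8: "p mod 8 = 1 \<longleftrightarrow> 4 dvd b'"
  proof -
    obtain a1 where a1: "a = 2 * a1 + 1" using ab(2) by (elim oddE)
    have "even (a1 * (a1 + 1))" by simp
    then obtain c where c: "a1 * (a1 + 1) = 2 * c" ..
    have "even b'" using even_b b' by auto
    then obtain b1 where b1: "b' = 2 * b1" ..
    have "b'\<^sup>2 = b\<^sup>2" using b' by auto
    then have p_c: "int p = 8 * c + 1 + 4 * b1\<^sup>2"
      using ab(1) a1 b1 c by (simp add: power2_eq_square algebra_simps)
    have "p mod 8 = 1 \<longleftrightarrow> even q" if "int p = 8 * c + 1 + 4 * q" for q
      using that by presburger
    from this[OF p_c] show ?thesis
      unfolding b1 by auto
  qed
  have five_b': "5 dvd b \<longleftrightarrow> 5 dvd b'"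
    using b' by auto
  have "odd (int u)" "\<not> 5 dvd int u" "even b'"
    using par(1) nd5 even_b b' by (auto simp: int_dvd_int_iff[of 5, simplified])
  then have "psi (int u) * (if 4 dvd b' then 1 else -1) = (if 5 dvd b' then 1 else -1)"
    using b'5 five_b' psi_s by (intro psi_shift) auto
  then show ?thesis
    unfolding chi_r mod8 five_b' .
qed

end

section \<open>Congruences between rational numbers\<close>

lemma p_integral_rats_quotient:
  assumes "coprime d (int p)"
  shows "of_int a / of_int d \<in> p_integral_rats p"
proof -
  have "snd (quotient_of (of_int a / of_int d)) = snd (Rat.normalize (a, d))"
    by (simp add: quotient_of_Fract flip: Fract_of_int_quotient)
  also have "\<dots> dvd d \<or> d = 0"
    by (auto simp: Rat.normalize_def Let_def dvd_div_iff_mult div_dvd_iff_mult)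
  finally show ?thesis
    using assms unfolding p_integral_rats_def
    by (cases "d = 0") (auto intro: coprime_divisors[of _ d _ "int p"] simp: Rat.normalize_def)
qed

lemma p_integral_congI:
  assumes "coprime d (int p)" "d \<noteq> 0" and "[N = t * d] (mod int m)"
  shows "p_integral_cong p (of_int N / of_int d) (of_int t) m"
proof -
  obtain q where "N - t * d = int m * q"
    using assms(3) by (auto simp: cong_iff_dvd_diff)
  then have "N = t * d + int m * q" by simp
  then have "(of_int N / of_int d - of_int t :: rat) = of_nat m * (of_int q / of_int d)"
    using assms(2) by (simp add: field_simps)
  moreover have "(of_int t :: rat) \<in> p_integral_rats p"
    using p_integral_rats_quotient[of 1 p t] by simp
  ultimately show ?thesis
    unfolding p_integral_cong_def using p_integral_rats_quotient[OF assms(1)] by blast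
qed

lemma coprime_prime_imp_cong_solve:
  fixes c m b :: int
  assumes "coprime c m"
  shows "\<exists>x. [c * x = b] (mod m)"
proof -
  obtain x where "[c * x = 1] (mod m)"
    using cong_solve_coprime_int[OF assms] by blast
  then have "[c * x * b = 1 * b] (mod m)"
    by (intro cong_mult cong_refl)
  then show ?thesis
    by (intro exI[of _ "x * b"]) (simp add: mult.assoc)
qed

text \<open>
  Quadratic reciprocity gives a square root modulo \<open>p\<close>, which one step of Hensel's lemma lifts.
\<close>

lemma sqrt_5_mod_prime_square:
  assumes p: "prime p" "odd p" and p5: "int p mod 5 \<in> {1, 4}"
  shows "\<exists>r. [r\<^sup>2 = 5] (mod (int p)\<^sup>2)"
proof -
  have p2: "2 < p"
    using p prime_gt_1_nat[OF p(1)] by (cases "p = 2") auto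
  have "p \<noteq> 5" using p5 by auto
  have "Legendre (int p) (int 5) * Legendre (int 5) (int p) = 1"
    using Quadratic_Reciprocity[OF p(1) p2, of 5] \<open>p \<noteq> 5\<close> by (simp add: power_mult mult.commute)
  then have "Legendre 5 (int p) = 1"
    using p5 by (auto simp: Legendre_5)
  then obtain r where r: "[r\<^sup>2 = 5] (mod int p)"
    by (auto simp: Legendre_def QuadRes_def split: if_splits)
  then obtain m where m: "r\<^sup>2 - 5 = int p * m"
    by (auto simp: cong_iff_dvd_diff)
  have pp: "prime (int p)" using p(1) by simp
  have "\<not> int p dvd 2 * r"
  proof
    assume "int p dvd 2 * r"
    moreover have "\<not> int p dvd 2"
      using p2 zdvd_imp_le[of "int p" 2] by auto
    ultimately have "int p dvd r"
      using pp by (simp add: prime_dvd_mult_iff)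
    then have "int p dvd r\<^sup>2 - (r\<^sup>2 - 5)"
      unfolding m by (intro dvd_diff) (auto simp: power2_eq_square)
    then have "int p dvd int 5" by simp
    then have "p dvd 5" by (simp only: of_nat_dvd_iff)
    then show False using p(1) \<open>p \<noteq> 5\<close> by (auto dest: primes_dvd_imp_eq[rotated 2])
  qed
  then have "coprime (2 * r) (int p)"
    using pp by (metis coprime_commute prime_imp_coprime)
  then obtain k where "[2 * r * k = - m] (mod int p)"
    using coprime_prime_imp_cong_solve by blast
  then obtain t where "2 * r * k - (- m) = int p * t"
    by (auto simp only: cong_iff_dvd_diff elim!: dvdE)
  then have t: "m = int p * t - 2 * r * k" by simp
  have "(r + int p * k)\<^sup>2 - 5 = (r\<^sup>2 - 5) + int p * (2 * r * k) + (int p)\<^sup>2 * k\<^sup>2"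
    by (simp add: power2_eq_square algebra_simps)
  also have "\<dots> = (int p)\<^sup>2 * (t + k\<^sup>2)"
    unfolding m unfolding t by (simp add: power2_eq_square algebra_simps)
  finally have "[(r + int p * k)\<^sup>2 = 5] (mod (int p)\<^sup>2)"
    by (simp add: cong_iff_dvd_diff)
  then show ?thesis by blast
qed

section \<open>The hypergeometric sum\<close>

text \<open>
  The terms with \<open>k > n div 2\<close> vanish modulo \<open>p\<close>. For the others, \<open>4k choose 2k\<close> is congruent to
  \<open>16^k (n choose 2k)\<close>.
\<close>

lemma quartic_sum_cong_hasse:
  fixes x \<alpha> \<beta> :: int
  assumes p: "prime p" "p = 2 * n + 1" and x: "[16 * x * \<alpha>\<^sup>2 = \<beta>] (mod int p)"
  shows "[\<alpha> ^ n * (\<Sum>k<p. int (quartic_coeff k) * x ^ k)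
      = coeff ([:0, \<beta>, \<alpha>, 1:] ^ n) (p - 1)] (mod int p)"
proof -
  have odd_p: "odd p" using p(2) by simp
  have "[(\<Sum>k<p. int (quartic_coeff k) * x ^ k)
      = (\<Sum>k<p. if k \<le> n div 2 then int (n choose (2 * k)) * int ((2 * k) choose k) * (16 * x) ^ k else 0)] (mod int p)"
  proof (rule cong_sum)
    fix k assume k: "k \<in> {..<p}"
    show "[int (quartic_coeff k) * x ^ k
        = (if k \<le> n div 2 then int (n choose (2 * k)) * int ((2 * k) choose k) * (16 * x) ^ k else 0)] (mod int p)"
    proof (cases "k \<le> n div 2")
      case True
      then have "2 * k \<le> n" by simp
      from central_binomial_cong[OF p this]
      have "[int ((4 * k) choose (2 * k)) = 16 ^ k * int (n choose (2 * k))] (mod int p)"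
        by (simp add: power_mult)
      then have "[int ((4 * k) choose (2 * k)) * (int ((2 * k) choose k) * x ^ k)
          = 16 ^ k * int (n choose (2 * k)) * (int ((2 * k) choose k) * x ^ k)] (mod int p)"
        by (rule cong_mult) simp
      then show ?thesis
        using True by (simp add: quartic_coeff_def power_mult_distrib mult_ac)
    next
      case False
      then have "p \<le> 4 * k" using p(2) by linarith
      then have "p dvd quartic_coeff k"
        using k by (intro prime_dvd_quartic_coeff[OF p(1) odd_p]) auto
      then show ?thesis
        using False by (simp add: cong_0_iff)
    qed
  qed
  also have "(\<Sum>k<p. if k \<le> n div 2 then int (n choose (2 * k)) * int ((2 * k) choose k) * (16 * x) ^ k else 0)
      = (\<Sum>k\<le>n div 2. int (n choose (2 * k)) * int ((2 * k) choose k) * (16 * x) ^ k)"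
    using p(2) by (intro sum.mono_neutral_cong_right) auto
  finally have "[\<alpha> ^ n * (\<Sum>k<p. int (quartic_coeff k) * x ^ k)
      = \<alpha> ^ n * (\<Sum>k\<le>n div 2. int (n choose (2 * k)) * int ((2 * k) choose k) * (16 * x) ^ k)] (mod int p)"
    by (intro cong_mult cong_refl)
  also have "\<alpha> ^ n * (\<Sum>k\<le>n div 2. int (n choose (2 * k)) * int ((2 * k) choose k) * (16 * x) ^ k)
      = (\<Sum>k\<le>n div 2. int (n choose (2 * k)) * int ((2 * k) choose k) * \<alpha> ^ (n - 2 * k) * (16 * x * \<alpha>\<^sup>2) ^ k)"
    unfolding sum_distrib_left
  proof (intro sum.cong refl)
    fix k assume "k \<in> {..n div 2}"
    then have "n = (n - 2 * k) + 2 * k" by auto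
    then have "\<alpha> ^ n = \<alpha> ^ (n - 2 * k) * (\<alpha>\<^sup>2) ^ k"
      by (metis power_add power_mult)
    then show "\<alpha> ^ n * (int (n choose (2 * k)) * int ((2 * k) choose k) * (16 * x) ^ k)
        = int (n choose (2 * k)) * int ((2 * k) choose k) * \<alpha> ^ (n - 2 * k) * (16 * x * \<alpha>\<^sup>2) ^ k"
      by (simp add: power_mult_distrib mult_ac)
  qed
  also have "[\<dots> = (\<Sum>k\<le>n div 2. int (n choose (2 * k)) * int ((2 * k) choose k) * \<alpha> ^ (n - 2 * k) * \<beta> ^ k)] (mod int p)"
    by (intro cong_sum cong_mult cong_pow x cong_refl)
  finally show ?thesis
    using hasse_invariant_2_torsion[of \<beta> \<alpha> n] p(2) by simp
qed

text \<open>
  The sum in question, with the inverse \<open>z\<close> of \<open>-6635520 = -(2^14 3^4 5)\<close> modulo \<open>p^2\<close>, is a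
  square modulo \<open>p^2\<close>; modulo \<open>p\<close> its root \<open>h\<close> is, up to sign, the Hasse invariant of
  \<open>y^2 = x^3 - r x\<close>.
\<close>

lemma cubic_sum_cong_square:
  assumes p: "prime p" "odd p" and p5: "int p mod 5 \<in> {1, 4}"
  shows "\<exists>r z h. [r\<^sup>2 = 5] (mod int p) \<and> [- 6635520 * z = 1] (mod (int p)\<^sup>2)
    \<and> [(\<Sum>k<p. int (cubic_coeff k) * z ^ k) = h\<^sup>2] (mod (int p)\<^sup>2)
    \<and> [h\<^sup>2 = (coeff ([:0, -r, 0, 1:] ^ ((p - 1) div 2)) (p - 1))\<^sup>2] (mod int p)"
proof -
  define n where "n = (p - 1) div 2"
  have pn: "p = 2 * n + 1"
    using p by (auto simp: n_def elim!: oddE)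
  have pp: "prime (int p)" using p(1) by simp
  obtain r where r2: "[r\<^sup>2 = 5] (mod (int p)\<^sup>2)"
    using sqrt_5_mod_prime_square[OF p p5] by blast
  then have r: "[r\<^sup>2 = 5] (mod int p)"
    by (rule cong_dvd_modulus) (simp add: power2_eq_square)
  have cop: "coprime (int q) (int p)" if "prime q" "q \<in> {2, 3, 5}" for q
  proof -
    have "p \<noteq> q" using that(2) p5 p(2) by auto
    then show ?thesis using that(1) p(1) by (simp add: primes_coprime)
  qed
  have cop235: "coprime 2 (int p)" "coprime 3 (int p)" "coprime 5 (int p)"
    using cop[of 2] cop[of 3] cop[of 5] by simp_all
  have cop_smooth: "coprime (2 ^ i * 3 ^ j * 5 ^ k) (int p ^ l)" for i j k l
    using cop235 by simp
  have "coprime 46080 ((int p)\<^sup>2)"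
    using cop_smooth[of 10 2 1 2] by simp
  \<comment> \<open>As \<open>r^2 = 5\<close>, this says that \<open>16 x (24 r)^2 = 360 - 161 r\<close>, the condition of \<open>quartic_sum_cong_hasse\<close> for the
      target of the isogeny. It also makes \<open>x (1 - 64 x)\<close> an inverse of \<open>-6635520 = -(46080^2 / 320)\<close>, since modulo \<open>p^2\<close>
      the numbers \<open>46080 x\<close> and \<open>46080 (1 - 64 x) = 64 (360 + 161 r)\<close> have the product \<open>64 (360^2 - 5 * 161^2) = -320\<close>.\<close>
  then obtain x where x: "[46080 * x = 360 - 161 * r] (mod (int p)\<^sup>2)"
    using coprime_prime_imp_cong_solve by blast
  define z where "z = x * (1 - 64 * x)"
  define h where "h = (\<Sum>k<p. int (quartic_coeff k) * x ^ k)"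
  have z: "[- 6635520 * z = 1] (mod (int p)\<^sup>2)"
  proof -
    have y: "[46080 - 64 * (46080 * x) = 46080 - 64 * (360 - 161 * r)] (mod (int p)\<^sup>2)"
      by (intro cong_diff cong_mult cong_refl x)
    have "[46080 * x * (46080 - 64 * (46080 * x)) = (360 - 161 * r) * (46080 - 64 * (360 - 161 * r))] (mod (int p)\<^sup>2)"
      by (rule cong_mult[OF x y])
    also have "(360 - 161 * r) * (46080 - 64 * (360 - 161 * r)) = 64 * (129600 - 25921 * r\<^sup>2)"
      by (simp add: power2_eq_square algebra_simps)
    also have "[\<dots> = 64 * (129600 - 25921 * 5)] (mod (int p)\<^sup>2)"
      by (intro cong_mult cong_diff cong_refl r2)
    finally have "[(320 * 46080 * 144) * z = (320 * 46080 * 144) * 0 - 320] (mod (int p)\<^sup>2)"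
      by (simp add: z_def algebra_simps)
    then have "[(-320) * (- 6635520 * z) = (-320) * 1] (mod (int p)\<^sup>2)"
      by simp
    moreover have "coprime (-320) ((int p)\<^sup>2)"
      using cop_smooth[of 6 0 1 2] by simp
    ultimately show ?thesis
      by (simp only: cong_mult_lcancel)
  qed
  have "[(\<Sum>k<p. int (cubic_coeff k) * z ^ k) = h\<^sup>2] (mod (int p)\<^sup>2)"
    unfolding z_def h_def by (rule clausen_truncated[OF p])
  moreover have "[h\<^sup>2 = (coeff ([:0, -r, 0, 1:] ^ n) (p - 1))\<^sup>2] (mod int p)"
  proof -
    have "[16 * x * (24 * r)\<^sup>2 = 360 - 161 * r] (mod int p)"
    proof -
      have "[(9216 * x) * r\<^sup>2 = (9216 * x) * 5] (mod int p)"
        by (intro cong_mult cong_refl r)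
      also have "(9216 * x) * 5 = 46080 * x" by simp
      also have "[46080 * x = 360 - 161 * r] (mod int p)"
        using x by (rule cong_dvd_modulus) (simp add: power2_eq_square)
      finally show ?thesis
        by (simp add: power_mult_distrib mult_ac)
    qed
    from quartic_sum_cong_hasse[OF p(1) pn this]
    have "[(24 * r) ^ n * h = coeff ([:0, 360 - 161 * r, 24 * r, 1:] ^ n) (p - 1)] (mod int p)"
      by (simp add: h_def)
    also have "[coeff ([:0, 360 - 161 * r, 24 * r, 1:] ^ n) (p - 1) = coeff ([:0, -r, 0, 1:] ^ n) (p - 1)] (mod int p)"
      using hasse_invariant_5_isogeny[OF p r] by (simp add: n_def cong_sym)
    finally have "[((24 * r) ^ n * h)\<^sup>2 = (coeff ([:0, -r, 0, 1:] ^ n) (p - 1))\<^sup>2] (mod int p)"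
      by (rule cong_pow)
    moreover have "[((24 * r) ^ n * h)\<^sup>2 = h\<^sup>2] (mod int p)"
    proof -
      have "\<not> int p dvd r"
      proof
        assume "int p dvd r"
        then have "int p dvd r\<^sup>2"
          by (simp add: power2_eq_square)
        moreover have "int p dvd r\<^sup>2 - 5"
          using r by (simp add: cong_iff_dvd_diff)
        ultimately have "int p dvd r\<^sup>2 - (r\<^sup>2 - 5)"
          by (rule dvd_diff)
        then have "int p dvd 5" by simp
        then show False
          using cop235(3) pp by (metis coprime_commute coprime_absorb_left not_prime_unit)
      qed
      moreover have "coprime 24 (int p)"
        using cop_smooth[of 3 1 0 1] by simp
      then have "\<not> int p dvd 24"
        using pp by (metis coprime_commute coprime_absorb_left not_prime_unit)
      ultimately have "\<not> int p dvd 24 * r"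
        using pp by (simp add: prime_dvd_mult_iff)
      then have "[(24 * r) ^ (p - 1) * h\<^sup>2 = 1 * h\<^sup>2] (mod int p)"
        by (intro cong_mult fermat_theorem_int p(1) cong_refl)
      moreover have "((24 * r) ^ n * h)\<^sup>2 = (24 * r) ^ (p - 1) * h\<^sup>2"
        by (simp add: power_mult_distrib pn mult.commute flip: power_mult)
      ultimately show ?thesis by simp
    qed
    ultimately show ?thesis
      by (metis cong_sym cong_trans)
  qed
  ultimately show ?thesis
    using r z unfolding n_def by blast
qed

theorem theorem3p10:
  fixes p :: nat and S :: rat
  assumes "prime p" and "odd p"
    and "[int p = 1] (mod 5) \<or> [int p = -1] (mod 5)"
  defines "S \<equiv> (\<Sum>k = 0..p - 1.
      of_nat (((2 * k) choose k)\<^sup>2 * ((4 * k) choose (2 * k))) / (- (2 ^ 14 * 3 ^ 4 * 5)) ^ k)"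
  shows "(\<forall>x y :: int. int p = x\<^sup>2 + 25 * y\<^sup>2 \<longrightarrow> p_integral_cong p S (of_int (4 * x\<^sup>2)) p) \<and>
         ([p = 3] (mod 4) \<longrightarrow> p_integral_cong p S 0 (p\<^sup>2))"
proof -
  have p5: "int p mod 5 \<in> {1, 4}"
    using assms(3) by (auto simp: cong_def)
  obtain r z h where r: "[r\<^sup>2 = 5] (mod int p)" and z: "[- 6635520 * z = 1] (mod (int p)\<^sup>2)"
    and sum: "[(\<Sum>k<p. int (cubic_coeff k) * z ^ k) = h\<^sup>2] (mod (int p)\<^sup>2)"
    and h: "[h\<^sup>2 = (coeff ([:0, -r, 0, 1:] ^ ((p - 1) div 2)) (p - 1))\<^sup>2] (mod int p)"
    using cubic_sum_cong_square[OF assms(1,2) p5] by blast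
  define n where "n = (p - 1) div 2"
  have pn: "p = 2 * n + 1"
    using assms(2) by (auto simp: n_def elim!: oddE)
  have pp: "prime (int p)" using assms(1) by simp
  have "p \<noteq> 5" using p5 by auto
  define M :: int where "M = - 6635520"
  define N where "N = (\<Sum>k<p. int (cubic_coeff k) * M ^ (p - 1 - k))"
  have coprime_M: "coprime (M ^ (p - 1)) (int p)"
  proof -
    have "coprime (M * z) ((int p)\<^sup>2)"
      using z unfolding M_def[symmetric] by (metis cong_imp_coprime cong_sym coprime_1_left)
    then show ?thesis by simp
  qed
  have S_eq: "S = of_int N / of_int (M ^ (p - 1))"
  proof -
    have "{0..p - 1} = {..<p}" using pn by auto
    then have "S = (\<Sum>k<p. of_nat (cubic_coeff k) / of_int M ^ k)"
      unfolding S_def M_def cubic_coeff_def by simp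
    also have "\<dots> = (\<Sum>k<p. of_int (int (cubic_coeff k) * M ^ (p - 1 - k)) / of_int (M ^ (p - 1)))"
    proof (intro sum.cong refl)
      fix k assume "k \<in> {..<p}"
      then have "p - 1 = (p - 1 - k) + k" by auto
      then have "M ^ (p - 1) = M ^ (p - 1 - k) * M ^ k"
        by (metis power_add)
      moreover have "(of_int M :: rat) \<noteq> 0" by (simp add: M_def)
      ultimately show "of_nat (cubic_coeff k) / of_int M ^ k
          = (of_int (int (cubic_coeff k) * M ^ (p - 1 - k)) / of_int (M ^ (p - 1)) :: rat)"
        by simp
    qed
    also have "\<dots> = of_int N / of_int (M ^ (p - 1))"
      by (simp add: N_def sum_divide_distrib)
    finally show ?thesis .
  qed
  have N: "[N = h\<^sup>2 * M ^ (p - 1)] (mod (int p)\<^sup>2)"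
  proof -
    have "[(\<Sum>k<p. int (cubic_coeff k) * z ^ k) * M ^ (p - 1) = N] (mod (int p)\<^sup>2)"
      unfolding N_def sum_distrib_right
    proof (rule cong_sum)
      fix k assume "k \<in> {..<p}"
      then have "p - 1 = (p - 1 - k) + k" by auto
      then have e: "M ^ (p - 1) = M ^ (p - 1 - k) * M ^ k"
        by (metis power_add)
      have "[int (cubic_coeff k) * M ^ (p - 1 - k) * (M * z) ^ k = int (cubic_coeff k) * M ^ (p - 1 - k) * 1 ^ k] (mod (int p)\<^sup>2)"
        using z unfolding M_def[symmetric] by (intro cong_mult cong_pow cong_refl)
      then show "[int (cubic_coeff k) * z ^ k * M ^ (p - 1) = int (cubic_coeff k) * M ^ (p - 1 - k)] (mod (int p)\<^sup>2)"
        unfolding e by (simp add: power_mult_distrib mult_ac)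
    qed
    moreover have "[(\<Sum>k<p. int (cubic_coeff k) * z ^ k) * M ^ (p - 1) = h\<^sup>2 * M ^ (p - 1)] (mod (int p)\<^sup>2)"
      by (intro cong_mult sum cong_refl)
    ultimately show ?thesis
      by (metis cong_sym cong_trans)
  qed
  have M0: "M ^ (p - 1) \<noteq> 0" by (simp add: M_def)
  have coeff_eq: "coeff ([:0, -r, 0, 1:] ^ n) (p - 1)
      = (\<Sum>k\<le>n div 2. int (n choose (2 * k)) * int ((2 * k) choose k) * 0 ^ (n - 2 * k) * (-r) ^ k)"
    using hasse_invariant_2_torsion[of "-r" 0 n] pn by simp

  have split: "p_integral_cong p S (of_int (4 * x\<^sup>2)) p" if xy: "int p = x\<^sup>2 + 25 * y\<^sup>2" for x y
  proof -
    have "odd (x\<^sup>2 + 25 * y\<^sup>2)" using assms(2) xy by (metis even_of_nat)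
    then have par: "even x \<longleftrightarrow> odd y" by auto
    have "even n"
    proof -
      have *: "int p mod 4 = 1" if ab: "int p = a\<^sup>2 + b\<^sup>2" "odd a" "even b" for a b
      proof -
        obtain a' b' where "a = 2 * a' + 1" "b = 2 * b'"
          using ab(2,3) by (auto elim!: evenE oddE)
        then have "int p = 1 + 4 * (a'\<^sup>2 + a' + b'\<^sup>2)"
          using ab(1) by (simp add: power2_eq_square algebra_simps)
        then show ?thesis by (simp only: mod_mult_self2) simp
      qed
      have "int p mod 4 = 1"
        using *[of x "5 * y"] *[of "5 * y" x] xy par by (cases "even x") (auto simp: power_mult_distrib)
      then show ?thesis using pn by presburger
    qed
    moreover have "n > 0" using pn prime_gt_1_nat[OF assms(1)] by simp
    ultimately interpret prime_1_mod_4 p n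
      using assms(1) pn by unfold_locales
    have "coeff ([:0, -r, 0, 1:] ^ n) (p - 1) = int (n choose (n div 2)) * (-r) ^ (n div 2)"
    proof -
      have "(\<Sum>k\<le>n div 2. int (n choose (2 * k)) * int ((2 * k) choose k) * 0 ^ (n - 2 * k) * (-r) ^ k)
          = (\<Sum>k\<le>n div 2. if k = n div 2 then int (n choose (n div 2)) * (-r) ^ (n div 2) else 0)"
      proof (intro sum.cong refl)
        fix k assume "k \<in> {..n div 2}"
        then have "n - 2 * k = 0 \<longleftrightarrow> k = n div 2"
          using even_n by (auto elim: evenE)
        then show "int (n choose (2 * k)) * int ((2 * k) choose k) * 0 ^ (n - 2 * k) * (-r) ^ k
            = (if k = n div 2 then int (n choose (n div 2)) * (-r) ^ (n div 2) else 0)"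
          using even_n by (cases "k = n div 2") (simp_all add: power_0_left)
      qed
      then show ?thesis unfolding coeff_eq by simp
    qed
    moreover have "((-r) ^ (n div 2))\<^sup>2 = r ^ n"
    proof -
      have "((-r) ^ (n div 2))\<^sup>2 = ((-r)\<^sup>2) ^ (n div 2)"
        by (simp only: mult.commute flip: power_mult)
      also have "\<dots> = r ^ (2 * (n div 2))"
        by (simp only: power2_minus power_mult)
      finally show ?thesis using even_n by simp
    qed
    ultimately have "(coeff ([:0, -r, 0, 1:] ^ n) (p - 1))\<^sup>2 = (int (n choose (n div 2)))\<^sup>2 * r ^ n"
      by (simp only: power_mult_distrib)
    moreover have "[(int (n choose (n div 2)))\<^sup>2 * r ^ n = 4 * a\<^sup>2 * chi r] (mod int p)"
      if "int p = a\<^sup>2 + b\<^sup>2" "odd a" for a b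
      by (intro cong_mult gauss_binomial_square[OF that] cong_sym[OF chi_power])
    ultimately have ha: "[h\<^sup>2 = 4 * a\<^sup>2 * chi r] (mod int p)" if "int p = a\<^sup>2 + b\<^sup>2" "odd a" for a b
      using h that unfolding n_def[symmetric] by (metis cong_trans)
    have "[h\<^sup>2 = 4 * x\<^sup>2] (mod int p)"
    proof (cases "even x")
      case False
      have e: "int p = x\<^sup>2 + (5 * y)\<^sup>2" using xy by simp
      have "chi r = 1"
        using chi_sqrt_5[OF r \<open>p \<noteq> 5\<close> e] False by simp
      then show ?thesis using ha[OF e] False by simp
    next
      case True
      have e: "int p = (5 * y)\<^sup>2 + x\<^sup>2" using xy by simp
      have "\<not> 5 dvd x"
      proof
        assume "5 dvd x"
        then have "5 dvd int p" unfolding xy by (auto simp: power2_eq_square)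
        then show False using p5 by auto
      qed
      then have "chi r = -1"
        using chi_sqrt_5[OF r \<open>p \<noteq> 5\<close> e] True par by simp
      then have "[h\<^sup>2 = - 4 * (5 * y)\<^sup>2] (mod int p)"
        using ha[OF e] True par by simp
      also have "[- 4 * (5 * y)\<^sup>2 = 4 * x\<^sup>2] (mod int p)"
        unfolding cong_iff_dvd_diff e by (rule dvdI[of _ _ "-4"]) simp
      finally show ?thesis .
    qed
    then have "[h\<^sup>2 * M ^ (p - 1) = 4 * x\<^sup>2 * M ^ (p - 1)] (mod int p)"
      by (intro cong_mult cong_refl)
    moreover have "[N = h\<^sup>2 * M ^ (p - 1)] (mod int p)"
      using N by (rule cong_dvd_modulus) (simp add: power2_eq_square)
    ultimately show ?thesis
      unfolding S_eq using coprime_M M0 by (intro p_integral_congI) (auto intro: cong_trans)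
  qed

  have inert: "p_integral_cong p S 0 (p\<^sup>2)" if "[p = 3] (mod 4)"
  proof -
    have "p mod 4 = 3" using that by (simp add: cong_def)
    then have "odd n" using pn by presburger
    then have "coeff ([:0, -r, 0, 1:] ^ n) (p - 1) = 0"
      unfolding coeff_eq
    proof (intro sum.neutral ballI)
      fix k assume "k \<in> {..n div 2}"
      then have "k \<le> n div 2" by simp
      then have "n - 2 * k \<noteq> 0" using \<open>odd n\<close> by presburger
      then show "int (n choose (2 * k)) * int ((2 * k) choose k) * 0 ^ (n - 2 * k) * (-r) ^ k = 0"
        by (simp add: power_0_left)
    qed
    then have "int p dvd h\<^sup>2"
      using h unfolding n_def[symmetric] by (simp add: cong_0_iff)
    then have "int p dvd h"
      using pp by (simp add: prime_dvd_power_iff)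
    then have "(int p)\<^sup>2 dvd h\<^sup>2 * M ^ (p - 1)"
      by (simp add: dvd_power_same)
    then have "[N = 0 * M ^ (p - 1)] (mod int (p\<^sup>2))"
      using N by (simp add: cong_0_iff cong_dvd_iff)
    from p_integral_congI[OF coprime_M M0 this] show ?thesis
      unfolding S_eq by simp
  qed

  show ?thesis
    using split inert by blast
qed

end
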